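(* Let $\ell\ge 1$ be an integer, $\theta=2\ell+1$, let $\gamma>1/\ell$ be a constant, and let $m=m(n)$ satisfy $\log m\sim\gamma\log n$ as $n\to\infty$. Consider bootstrap percolation with threshold $\theta$ on $\mathbb{Z}_m\times K_n^2$ with initial density $p=p(n)$ satisfying, for a constant $a>0$, $$p\sim a\cdot\frac{(\log n)^{1/\ell}}{n^{1+1/\ell}}\qquad (n\to\infty).$$ Then the final occupied set $\omega_\infty$ is scarce when $a^\ell/\ell!<1/\ell$ and abundant when $a^\ell/\ell!>1/\ell$.
   Context: $\mathbb{Z}_m$ denotes the cycle graph on $m$ vertices, $K_n$ the complete graph on $n$ vertices, $K_n^2=K_n\times K_n$, and $\times$ the Cartesian product of graphs. Bootstrap percolation with threshold $\theta$ on a finite graph with vertex set $V$: starting from $\omega=\omega_0\in\{0,1\}^V$, set $\omega_{j+1}(v)=1$ if $\omega_j(v)=1$ or $\sum_{w\sim v}\omega_j(w)\ge\theta$, and $\omega_{j+1}(v)=0$ otherwise; $\omega_\infty$ is the pointwise limit, identified with the occupied set $\{v:\omega_\infty(v)=1\}$. The initial values $\{\omega(v):v\in V\}$ are i.i.d. Bernoulli($p$). Random sets $A\subset V$ (depending on $n$) are called abundant if $|A|/|V|\to 1$ in probability, and scarce if $|A|/|V|\to 0$ in probability, as $n\to\infty$. *)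

theory Defs
  imports "HOL-Probability.Probability" "HOL-Library.Landau_Symbols"
    "Graph_Theory.Kuratowski"
begin

text \<open>
  Following Graph_Theory, a simple undirected graph is a loop-free digraph with a symmetric
  set of arcs given as pairs of vertices.
\<close>

text \<open>
  The condition \<open>i \<noteq> j\<close> only matters for \<open>m \<le> 2\<close>, where it yields
  a single vertex without loop (\<open>m = 1\<close>) and a single edge (\<open>m = 2\<close>).
\<close>
definition cycle_graph :: "nat \<Rightarrow> nat pair_pre_digraph" where
  "cycle_graph m = \<lparr> pverts = {..<m},
     parcs = {(i, j). i < m \<and> j < m \<and> i \<noteq> j \<and> (j = Suc i mod m \<or> i = Suc j mod m)} \<rparr>"

definition full_graph :: "nat \<Rightarrow> nat pair_pre_digraph" where
  "full_graph n = \<lparr> pverts = {..<n}, parcs = {(i, j). i < n \<and> j < n \<and> i \<noteq> j} \<rparr>"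

definition cartesian_product ::
  "'a pair_pre_digraph \<Rightarrow> 'b pair_pre_digraph \<Rightarrow> ('a \<times> 'b) pair_pre_digraph" (infixr "\<box>" 80) where
  "G \<box> H = \<lparr> pverts = pverts G \<times> pverts H,
     parcs = {((x, y), (x', y')).
       (x = x' \<and> x \<in> pverts G \<and> (y, y') \<in> parcs H) \<or>
       ((x, x') \<in> parcs G \<and> y = y' \<and> y \<in> pverts H)} \<rparr>"

definition bootstrap_step :: "'a pair_pre_digraph \<Rightarrow> nat \<Rightarrow> ('a \<Rightarrow> bool) \<Rightarrow> 'a \<Rightarrow> bool" where
  "bootstrap_step G \<theta> \<omega> v \<longleftrightarrow>
     \<omega> v \<or> (\<Sum>w | w \<in> pverts G \<and> (v, w) \<in> parcs G. of_bool (\<omega> w)) \<ge> \<theta>"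

definition final_occupied :: "'a pair_pre_digraph \<Rightarrow> nat \<Rightarrow> ('a \<Rightarrow> bool) \<Rightarrow> 'a set" where
  "final_occupied G \<theta> \<omega> =
     {v \<in> pverts G. (\<lambda>j. of_bool ((bootstrap_step G \<theta> ^^ j) \<omega> v) :: real) \<longlonglongrightarrow> 1}"

text \<open>Configurations are set to \<open>False\<close> outside the (finite) vertex set.\<close>
definition initial_law :: "'a pair_pre_digraph \<Rightarrow> real \<Rightarrow> ('a \<Rightarrow> bool) pmf" where
  "initial_law G p = Pi_pmf (pverts G) False (\<lambda>_. bernoulli_pmf p)"

text \<open>
  Convergence in probability to a constant; the random variables may live on different
  probability spaces.
\<close>
definition tendsto_const_in_prob ::
  "(nat \<Rightarrow> 'c measure) \<Rightarrow> (nat \<Rightarrow> 'c \<Rightarrow> real) \<Rightarrow> real \<Rightarrow> bool" where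
  "tendsto_const_in_prob M X c \<longleftrightarrow>
     (\<forall>\<epsilon>>0. (\<lambda>n. measure (M n) {x \<in> space (M n). \<bar>X n x - c\<bar> > \<epsilon>}) \<longlonglongrightarrow> 0)"

definition abundant ::
  "(nat \<Rightarrow> 'c measure) \<Rightarrow> (nat \<Rightarrow> 'a set) \<Rightarrow> (nat \<Rightarrow> 'c \<Rightarrow> 'a set) \<Rightarrow> bool" where
  "abundant M V A \<longleftrightarrow>
     tendsto_const_in_prob M (\<lambda>n x. real (card (A n x)) / real (card (V n))) 1"

definition scarce ::
  "(nat \<Rightarrow> 'c measure) \<Rightarrow> (nat \<Rightarrow> 'a set) \<Rightarrow> (nat \<Rightarrow> 'c \<Rightarrow> 'a set) \<Rightarrow> bool" where
  "scarce M V A \<longleftrightarrow>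
     tendsto_const_in_prob M (\<lambda>n x. real (card (A n x)) / real (card (V n))) 0"

lemma pair_graph_cycle_graph: "pair_graph (cycle_graph m)"
  by unfold_locales
     (auto simp: cycle_graph_def symmetric_def intro!: symI intro: finite_subset[of _ "{..<m} \<times> {..<m}"])

lemma pair_graph_full_graph: "pair_graph (full_graph n)"
  by unfold_locales
     (auto simp: full_graph_def symmetric_def intro!: symI intro: finite_subset[of _ "{..<n} \<times> {..<n}"])

lemma complete_digraph_full_graph: "complete_digraph n (with_proj (full_graph n))"
proof -
  interpret pair_graph "full_graph n" by (rule pair_graph_full_graph)
  have "graph (with_proj (full_graph n))"
    by unfold_locales (use pair_sym_arcs in simp)
  then show ?thesis
    by (auto simp: complete_digraph_def full_graph_def arcs_ends_def arc_to_ends_def)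
qed

lemma pair_graph_cartesian_product:
  assumes "pair_graph G" "pair_graph H"
  shows "pair_graph (G \<box> H)"
proof -
  interpret G: pair_graph G by fact
  interpret H: pair_graph H by fact
  have arcs: "parcs (G \<box> H) \<subseteq> (pverts G \<times> pverts H) \<times> (pverts G \<times> pverts H)"
    by (auto simp: cartesian_product_def
        dest: G.arc_fst_in_verts G.arc_snd_in_verts H.arc_fst_in_verts H.arc_snd_in_verts)
  have fin: "finite (pverts (G \<box> H))"
    by (simp add: cartesian_product_def)
  have fin_arcs: "finite (parcs (G \<box> H))"
    using arcs by (rule finite_subset) simp
  have sym: "sym (parcs (G \<box> H))"
    using G.sym_arcs H.sym_arcs
    by (auto simp: cartesian_product_def symmetric_def intro!: symI dest: symD)
  show ?thesis
  proof
    show "finite (pverts (G \<box> H))" by (fact fin)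
    show "finite (parcs (G \<box> H))" by (fact fin_arcs)
    show "symmetric (with_proj (G \<box> H))" using sym by (simp add: symmetric_def)
    fix e assume e: "e \<in> parcs (G \<box> H)"
    show "fst e \<in> pverts (G \<box> H)" "snd e \<in> pverts (G \<box> H)"
      using subsetD[OF arcs e] by (auto simp: cartesian_product_def mem_Times_iff)
    show "fst e \<noteq> snd e"
      using e G.no_loops H.no_loops by (auto simp: cartesian_product_def)
  qed
qed

lemma mem_final_occupied_iff:
  "v \<in> final_occupied G \<theta> \<omega> \<longleftrightarrow> v \<in> pverts G \<and> (\<exists>j. (bootstrap_step G \<theta> ^^ j) \<omega> v)"
proof -
  let ?f = "\<lambda>j. (bootstrap_step G \<theta> ^^ j) \<omega> v"
  have mono: "?f j \<Longrightarrow> ?f (j + k)" for j k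
    by (induction k) (auto simp: bootstrap_step_def)
  have "(\<lambda>j. of_bool (?f j) :: real) \<longlonglongrightarrow> 1" if "?f j" for j
  proof (rule tendsto_eventually)
    show "\<forall>\<^sub>F i in sequentially. of_bool (?f i) = (1 :: real)"
      using mono[OF that] by (auto simp: eventually_sequentially le_iff_add intro!: exI[of _ j])
  qed
  moreover have "\<exists>j. ?f j" if "(\<lambda>j. of_bool (?f j) :: real) \<longlonglongrightarrow> 1"
  proof (rule ccontr)
    assume "\<not> (\<exists>j. ?f j)"
    then show False using that by (simp add: LIMSEQ_const_iff)
  qed
  ultimately show ?thesis by (auto simp: final_occupied_def)
qed

end

theory Submission
  imports Defs "HOL-Real_Asymp.Real_Asymp"
begin

text \<open>
  Write \<open>c = a ^ l / l!\<close>. A layer is a copy of the product of two complete graphs, and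
  a row of a layer contains at least \<open>l\<close> initially occupied vertices with probability about
  \<open>c ln n / n\<close>, so a layer has no such row with probability \<open>n\<close> to the power
  \<open>- c + o(1)\<close>. Rows with \<open>l + 1\<close> occupied vertices first occur within about
  \<open>n\<close> to the power \<open>1 / l\<close> layers.

  Consider a window of \<open>N = n powr h\<close> layers. If \<open>c > h > 1 / l\<close>, with high probability
  every layer of the window has \<open>2 * l + 1\<close> rows and as many columns with \<open>l\<close>
  occupied vertices each, so that it fills up as soon as a neighbouring layer is full, and some
  layer of the window has a row with \<open>l + 1\<close> occupied vertices and fills up by itself. If
  \<open>c < h < 1 / l\<close>, with high probability the window contains layers without rows of
  \<open>l\<close> occupied vertices on both sides of a given layer, no line of it has
  \<open>l + 1\<close> occupied vertices, and no occupied vertex is adjacent, in the cycle direction, to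
  a vertex with \<open>2 * l - 1\<close> occupied neighbours in its own layer; then nothing ever
  changes between these two layers, even if everything outside becomes occupied.
\<close>

section \<open>Independence and Chernoff bounds for Bernoulli fields\<close>

abbreviation bernoulli_field :: "'a set \<Rightarrow> real \<Rightarrow> ('a \<Rightarrow> bool) pmf" where
  "bernoulli_field V p \<equiv> Pi_pmf V False (\<lambda>_. bernoulli_pmf p)"

abbreviation field_prob :: "'a set \<Rightarrow> real \<Rightarrow> ('a \<Rightarrow> bool) set \<Rightarrow> real" where
  "field_prob V p \<equiv> measure_pmf.prob (bernoulli_field V p)"

abbreviation field_expectation :: "'a set \<Rightarrow> real \<Rightarrow> (('a \<Rightarrow> bool) \<Rightarrow> real) \<Rightarrow> real" where
  "field_expectation V p \<equiv> measure_pmf.expectation (bernoulli_field V p)"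

text \<open>Plays the role of measurability with respect to the coordinates in \<open>A\<close>:
  independence is always obtained from disjoint sets of coordinates.\<close>

definition depends_on :: "'a set \<Rightarrow> (('a \<Rightarrow> bool) \<Rightarrow> 'b) \<Rightarrow> bool" where
  "depends_on A f \<longleftrightarrow> (\<forall>\<omega> \<omega>'. (\<forall>v\<in>A. \<omega> v = \<omega>' v) \<longrightarrow> f \<omega> = f \<omega>')"

definition occ_count :: "'a set \<Rightarrow> ('a \<Rightarrow> bool) \<Rightarrow> nat" where
  "occ_count A \<omega> = card {v \<in> A. \<omega> v}"

lemma depends_onD: "depends_on A f \<Longrightarrow> (\<And>v. v \<in> A \<Longrightarrow> \<omega> v = \<omega>' v) \<Longrightarrow> f \<omega> = f \<omega>'"
  by (auto simp: depends_on_def)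

lemma depends_on_occ_count: "A \<subseteq> B \<Longrightarrow> depends_on B (\<lambda>\<omega>. f (occ_count A \<omega>))"
  unfolding depends_on_def occ_count_def
  by (auto intro!: arg_cong[of _ _ f] arg_cong[of _ _ card])

lemma finite_set_bernoulli_field [simp]: "finite V \<Longrightarrow> finite (set_pmf (bernoulli_field V p))"
  by (rule finite_subset[OF set_Pi_pmf_subset']) (auto intro: finite_PiE_dflt)

lemma integrable_bernoulli_field [simp]:
  fixes f :: "_ \<Rightarrow> real"
  shows "finite V \<Longrightarrow> integrable (bernoulli_field V p) f"
  by (intro integrable_measure_pmf_finite) simp

lemma expectation_pair_pmf_mult:
  fixes f g :: "_ \<Rightarrow> real"
  assumes "finite (set_pmf P)" "finite (set_pmf Q)"
  shows "measure_pmf.expectation (pair_pmf P Q) (\<lambda>(x, y). f x * g y) =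
         measure_pmf.expectation P f * measure_pmf.expectation Q g"
proof -
  have "measure_pmf.expectation (pair_pmf P Q) (\<lambda>(x, y). f x * g y) =
     (\<Sum>z\<in>set_pmf P \<times> set_pmf Q. (case z of (x, y) \<Rightarrow> f x * g y) * pmf (pair_pmf P Q) z)"
    using assms by (intro integral_measure_pmf_real) auto
  also have "\<dots> = (\<Sum>(x, y)\<in>set_pmf P \<times> set_pmf Q. (f x * pmf P x) * (g y * pmf Q y))"
    by (intro sum.cong) (auto simp: pmf_pair mult_ac)
  also have "\<dots> = (\<Sum>x\<in>set_pmf P. f x * pmf P x) * (\<Sum>y\<in>set_pmf Q. g y * pmf Q y)"
    by (simp add: sum_product sum.cartesian_product)
  also have "\<dots> = measure_pmf.expectation P f * measure_pmf.expectation Q g"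
    using assms by (simp add: integral_measure_pmf_real[of "set_pmf P"] integral_measure_pmf_real[of "set_pmf Q"])
  finally show ?thesis .
qed

text \<open>The field on \<open>V\<close> glues independent fields on \<open>A\<close> and
  \<open>V - A\<close>; since \<open>B\<close> lies in \<open>V - A\<close>, \<open>f\<close> sees
  only the first and \<open>g\<close> only the second.\<close>

lemma field_expectation_mult:
  assumes "finite V" "A \<inter> B = {}" "A \<subseteq> V" "B \<subseteq> V" "depends_on A f" "depends_on B g"
  shows "field_expectation V p (\<lambda>\<omega>. f \<omega> * g \<omega>) = field_expectation V p f * field_expectation V p g"
proof -
  have V: "V = A \<union> (V - A)" using assms by auto
  have fin: "finite A" "finite (V - A)" using assms finite_subset by auto
  let ?P = "bernoulli_field A p" and ?Q = "bernoulli_field (V - A) p"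
  let ?h = "\<lambda>(f, g) x. if x \<in> A then f x else g x"
  have eq: "bernoulli_field V p = map_pmf ?h (pair_pmf ?P ?Q)"
    by (subst V, rule Pi_pmf_union) (use fin in auto)
  have f: "f (?h z) = f (fst z)" for z
    by (rule depends_onD[OF assms(5)]) (auto split: prod.split)
  have g: "g (?h z) = g (snd z)" for z
    by (rule depends_onD[OF assms(6)]) (use assms(2) in \<open>auto split: prod.split\<close>)
  \<comment> \<open>Stated for all \<open>F\<close> and \<open>G\<close> so that the constant 1 can
    replace either of them, which identifies the two marginal expectations.\<close>
  have *: "field_expectation V p (\<lambda>\<omega>. F \<omega> * G \<omega>) = measure_pmf.expectation ?P F * measure_pmf.expectation ?Q G"
    if "\<And>z. F (?h z) = F (fst z)" "\<And>z. G (?h z) = G (snd z)" for F G :: "_ \<Rightarrow> real"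
    unfolding eq integral_map_pmf that
    using expectation_pair_pmf_mult[of ?P ?Q F G] fin by (simp add: case_prod_unfold)
  show ?thesis
    using *[of f g, OF f g] *[of f "\<lambda>_. 1", OF f refl] *[of "\<lambda>_. 1" g, OF refl g] by simp
qed

lemma field_expectation_prod:
  assumes "finite V" "finite I" "disjoint_family_on A I"
    "\<And>i. i \<in> I \<Longrightarrow> A i \<subseteq> V" "\<And>i. i \<in> I \<Longrightarrow> depends_on (A i) (f i)"
  shows "field_expectation V p (\<lambda>\<omega>. \<Prod>i\<in>I. f i \<omega>) = (\<Prod>i\<in>I. field_expectation V p (f i))"
  using assms(2-)
proof (induction I rule: finite_induct)
  case (insert i I)
  have dis: "disjoint_family_on A I" "A i \<inter> (\<Union>j\<in>I. A j) = {}"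
    using insert.prems(1) insert.hyps(2) by (auto simp: disjoint_family_on_def)
  have dep: "depends_on (\<Union>j\<in>I. A j) (\<lambda>\<omega>. \<Prod>j\<in>I. f j \<omega>)"
    unfolding depends_on_def
  proof (intro allI impI prod.cong refl)
    fix \<omega> \<omega>' :: "'a \<Rightarrow> bool" and j assume *: "\<forall>v\<in>\<Union> (A ` I). \<omega> v = \<omega>' v" and j: "j \<in> I"
    show "f j \<omega> = f j \<omega>'"
      by (rule depends_onD[of "A j"]) (use insert.prems(3) * j in auto)
  qed
  have "field_expectation V p (\<lambda>\<omega>. f i \<omega> * (\<Prod>j\<in>I. f j \<omega>)) =
        field_expectation V p (f i) * field_expectation V p (\<lambda>\<omega>. \<Prod>j\<in>I. f j \<omega>)"
    by (rule field_expectation_mult[OF assms(1) dis(2)]) (use insert.prems dep in auto)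
  also have "field_expectation V p (\<lambda>\<omega>. \<Prod>j\<in>I. f j \<omega>) = (\<Prod>j\<in>I. field_expectation V p (f j))"
    using insert.prems dis by (intro insert.IH) auto
  finally show ?case using insert.hyps by simp
qed simp

lemma field_prob_INT:
  assumes "finite V" "finite I" "disjoint_family_on A I"
    "\<And>i. i \<in> I \<Longrightarrow> A i \<subseteq> V" "\<And>i. i \<in> I \<Longrightarrow> depends_on (A i) (P i)"
  shows "field_prob V p {\<omega>. \<forall>i\<in>I. P i \<omega>} = (\<Prod>i\<in>I. field_prob V p {\<omega>. P i \<omega>})"
proof -
  have "field_prob V p {\<omega>. \<forall>i\<in>I. P i \<omega>} = field_expectation V p (\<lambda>\<omega>. indicator {\<omega>. \<forall>i\<in>I. P i \<omega>} \<omega>)"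
    by simp
  also have "(\<lambda>\<omega>. indicator {\<omega>. \<forall>i\<in>I. P i \<omega>} \<omega>) = (\<lambda>\<omega>. \<Prod>i\<in>I. indicator {\<omega>. P i \<omega>} \<omega> :: real)"
    using assms(2) by (auto simp: fun_eq_iff indicator_def prod_eq_1_iff)
  also have "field_expectation V p \<dots> = (\<Prod>i\<in>I. field_expectation V p (indicator {\<omega>. P i \<omega>}))"
    by (rule field_expectation_prod[OF assms(1-4)])
       (use assms(5) in \<open>auto simp: depends_on_def indicator_def\<close>)
  finally show ?thesis by simp
qed

text \<open>Chernoff's bound: Markov's inequality for \<open>t\<close> to the power of the number of events.\<close>
lemma field_prob_few_events:
  fixes t q :: real
  assumes V: "finite V" "finite I" "disjoint_family_on A I"
    "\<And>i. i \<in> I \<Longrightarrow> A i \<subseteq> V" "\<And>i. i \<in> I \<Longrightarrow> depends_on (A i) (P i)"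
    and q: "\<And>i. i \<in> I \<Longrightarrow> q \<le> field_prob V p {\<omega>. P i \<omega>}"
    and t: "0 < t" "t < 1"
  shows "field_prob V p {\<omega>. card {i \<in> I. P i \<omega>} < k} \<le> exp (- (1 - t) * (q * card I)) / t ^ k"
proof -
  let ?F = "\<lambda>\<omega>. \<Prod>i\<in>I. if P i \<omega> then t else 1"
  have F: "?F \<omega> = t ^ card {i \<in> I. P i \<omega>}" for \<omega>
    using V(2) by (simp add: prod.If_cases Int_def)
  have "field_prob V p {\<omega>. card {i \<in> I. P i \<omega>} < k} \<le> field_prob V p {\<omega> \<in> space (bernoulli_field V p). t ^ k \<le> ?F \<omega>}"
    using t by (intro measure_pmf.finite_measure_mono) (auto simp: F intro!: power_decreasing)
  also have "\<dots> \<le> field_expectation V p ?F / t ^ k"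
    by (rule integral_Markov_inequality_measure) (use V t in \<open>auto intro!: prod_nonneg\<close>)
  also have "field_expectation V p ?F = (\<Prod>i\<in>I. field_expectation V p (\<lambda>\<omega>. if P i \<omega> then t else 1))"
    by (rule field_expectation_prod[OF V(1-4)]) (use V(5) in \<open>auto simp: depends_on_def\<close>)
  also have "\<dots> \<le> (\<Prod>i\<in>I. exp (- (1 - t) * q))"
  proof (rule prod_mono, intro conjI)
    fix i assume i: "i \<in> I"
    \<comment> \<open>Each factor is affine in an indicator, so its expectation is explicit, and
      \<open>1 + x \<le> exp x\<close> turns the product into one exponential.\<close>
    have "(\<lambda>\<omega>. if P i \<omega> then t else 1) = (\<lambda>\<omega>. 1 - (1 - t) * indicator {\<omega>. P i \<omega>} \<omega>)"
      by (auto simp: fun_eq_iff)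
    then have "field_expectation V p (\<lambda>\<omega>. if P i \<omega> then t else 1) =
        field_expectation V p (\<lambda>\<omega>. 1 - (1 - t) * indicator {\<omega>. P i \<omega>} \<omega>)" by simp
    also have "\<dots> = 1 - (1 - t) * field_prob V p {\<omega>. P i \<omega>}"
      using V(1) by (subst Bochner_Integration.integral_diff) auto
    also have "\<dots> \<le> 1 - (1 - t) * q"
      using q[OF i] t by (auto intro!: mult_left_mono)
    also have "\<dots> \<le> exp (- (1 - t) * q)"
      using exp_ge_add_one_self[of "- (1 - t) * q"] by (simp add: algebra_simps)
    finally show "field_expectation V p (\<lambda>\<omega>. if P i \<omega> then t else 1) \<le> exp (- (1 - t) * q)" .
    show "0 \<le> field_expectation V p (\<lambda>\<omega>. if P i \<omega> then t else 1)"
      using t by (intro Bochner_Integration.integral_nonneg) auto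
  qed
  also have "\<dots> = exp (- (1 - t) * (q * card I))"
    by (simp add: exp_of_nat_mult[symmetric] mult_ac)
  finally show ?thesis using t by (simp add: divide_right_mono)
qed

lemma field_prob_UN_le:
  assumes "finite I"
  shows "field_prob V p (\<Union>i\<in>I. E i) \<le> (\<Sum>i\<in>I. field_prob V p (E i))"
  using assms by (intro measure_pmf.finite_measure_subadditive_finite) auto

section \<open>Probability bounds for occupation counts\<close>

lemma field_prob_all_occupied:
  assumes "finite V" "S \<subseteq> V" "p \<in> {0..1}"
  shows "field_prob V p {\<omega>. \<forall>v\<in>S. \<omega> v} = p ^ card S"
proof -
  have "{\<omega>. \<forall>v\<in>S. \<omega> v} = Pi V (\<lambda>v. if v \<in> S then {True} else UNIV)"
    using assms(2) by (auto simp: Pi_def split: if_splits)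
  then have "field_prob V p {\<omega>. \<forall>v\<in>S. \<omega> v} =
      (\<Prod>v\<in>V. measure_pmf.prob (bernoulli_pmf p) (if v \<in> S then {True} else UNIV))"
    using measure_Pi_pmf_Pi[OF assms(1)] by simp
  also have "\<dots> = (\<Prod>v\<in>V. if v \<in> S then p else 1)"
    using assms(3) by (intro prod.cong) (auto simp: measure_pmf_single)
  also have "\<dots> = p ^ card S"
    using assms(1,2) by (simp add: prod.If_cases Int_absorb1)
  finally show ?thesis .
qed

text \<open>Union bound over the \<open>j\<close>-element subsets of \<open>A\<close>. The set
  \<open>B\<close> is empty for single lines and one vertex of another layer for crosses.\<close>

lemma field_prob_occ_count_ge_le:
  fixes p :: real
  assumes V: "finite V" "A \<subseteq> V" "B \<subseteq> V" "A \<inter> B = {}" and p: "p \<in> {0..1}"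
  shows "field_prob V p {\<omega>. (\<forall>v\<in>B. \<omega> v) \<and> j \<le> occ_count A \<omega>} \<le> (card A choose j) * p ^ (j + card B)"
proof -
  let ?S = "{S. S \<subseteq> A \<and> card S = j}"
  have fin: "finite A" "finite B" using V(1) finite_subset[OF V(2)] finite_subset[OF V(3)] by auto
  have "{\<omega>. (\<forall>v\<in>B. \<omega> v) \<and> j \<le> occ_count A \<omega>} \<subseteq> (\<Union>S\<in>?S. {\<omega>. \<forall>v\<in>S \<union> B. \<omega> v})"
  proof safe
    fix \<omega> assume B: "\<forall>v\<in>B. \<omega> v" and "j \<le> occ_count A \<omega>"
    then obtain S where S: "S \<subseteq> {v \<in> A. \<omega> v}" "card S = j"
      unfolding occ_count_def by (meson obtain_subset_with_card_n)
    then show "\<omega> \<in> (\<Union>S\<in>?S. {\<omega>. \<forall>v\<in>S \<union> B. \<omega> v})"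
      using B by (intro UN_I[of S]) auto
  qed
  then have "field_prob V p {\<omega>. (\<forall>v\<in>B. \<omega> v) \<and> j \<le> occ_count A \<omega>} \<le>
      field_prob V p (\<Union>S\<in>?S. {\<omega>. \<forall>v\<in>S \<union> B. \<omega> v})"
    by (intro measure_pmf.finite_measure_mono) auto
  also have "\<dots> \<le> (\<Sum>S\<in>?S. field_prob V p {\<omega>. \<forall>v\<in>S \<union> B. \<omega> v})"
    by (rule field_prob_UN_le) (use fin in auto)
  also have "\<dots> = (\<Sum>S\<in>?S. p ^ (j + card B))"
  proof (intro sum.cong refl)
    fix S assume "S \<in> ?S"
    then have S: "S \<subseteq> A" "card S = j" by auto
    then have "card (S \<union> B) = j + card B"
      using V fin finite_subset[of S A] by (subst card_Un_disjoint) auto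
    then show "field_prob V p {\<omega>. \<forall>v\<in>S \<union> B. \<omega> v} = p ^ (j + card B)"
      using field_prob_all_occupied[of V "S \<union> B" p] S V p by auto
  qed
  also have "\<dots> = (card A choose j) * p ^ (j + card B)"
    using fin by (simp add: n_subsets)
  finally show ?thesis .
qed

text \<open>The count is binomially distributed, and the event of exactly \<open>j\<close> occupied
  vertices already gives the bound.\<close>

lemma field_prob_occ_count_ge_ge:
  fixes p :: real
  assumes V: "finite V" "A \<subseteq> V" and p: "p \<in> {0..1}" and j: "j \<le> card A"
  shows "(card A choose j) * p ^ j * (1 - p) ^ (card A - j) \<le> field_prob V p {\<omega>. j \<le> occ_count A \<omega>}"
proof -
  have fin: "finite A" using V finite_subset by auto
  let ?r = "\<lambda>f x. if x \<in> A then f x else False"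
  have r: "occ_count A (?r \<omega>) = occ_count A \<omega>" for \<omega>
    unfolding occ_count_def by (rule arg_cong[of _ _ card]) auto
  have eq: "binomial_pmf (card A) p = map_pmf (occ_count A) (bernoulli_field V p)"
    unfolding binomial_pmf_altdef'[of A "card A" p False, OF fin refl p] Pi_pmf_subset[OF V] map_pmf_comp
    using r by (simp add: occ_count_def[abs_def])
  have "(card A choose j) * p ^ j * (1 - p) ^ (card A - j) = pmf (binomial_pmf (card A) p) j"
    using p j by simp
  also have "\<dots> = field_prob V p {\<omega>. occ_count A \<omega> = j}"
    unfolding eq pmf_map by (simp add: vimage_def)
  also have "\<dots> \<le> field_prob V p {\<omega>. j \<le> occ_count A \<omega>}"
    by (intro measure_pmf.finite_measure_mono) auto
  finally show ?thesis .
qed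

section \<open>The layered graph and closure of the final set\<close>

abbreviation layered_graph :: "nat \<Rightarrow> nat \<Rightarrow> (nat \<times> nat \<times> nat) pair_pre_digraph" where
  "layered_graph m n \<equiv> cycle_graph m \<box> full_graph n \<box> full_graph n"

abbreviation grid_row :: "nat \<Rightarrow> nat \<Rightarrow> nat set \<Rightarrow> (nat \<times> nat \<times> nat) set" where
  "grid_row k x Y \<equiv> {k} \<times> {x} \<times> Y"

abbreviation grid_col :: "nat \<Rightarrow> nat set \<Rightarrow> nat \<Rightarrow> (nat \<times> nat \<times> nat) set" where
  "grid_col k X y \<equiv> {k} \<times> X \<times> {y}"

abbreviation layer :: "nat \<Rightarrow> nat \<Rightarrow> (nat \<times> nat \<times> nat) set" where
  "layer n k \<equiv> {k} \<times> {..<n} \<times> {..<n}"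

text \<open>The neighbours of \<open>(k, x, y)\<close> inside its own layer.\<close>

definition cross :: "nat \<Rightarrow> nat \<Rightarrow> nat \<Rightarrow> nat \<Rightarrow> (nat \<times> nat \<times> nat) set" where
  "cross n k x y = grid_row k x ({..<n} - {y}) \<union> grid_col k ({..<n} - {x}) y"

lemma pverts_layered_graph: "pverts (layered_graph m n) = {..<m} \<times> {..<n} \<times> {..<n}"
  by (simp add: cartesian_product_def cycle_graph_def full_graph_def)

lemma neighbours_layered_graph:
  assumes "k < m" "x < n" "y < n"
  shows "{w \<in> pverts (layered_graph m n). ((k, x, y), w) \<in> parcs (layered_graph m n)} =
    cross n k x y \<union> {k'. (k, k') \<in> parcs (cycle_graph m)} \<times> {x} \<times> {y}"
  using assms
  by (auto simp: cartesian_product_def full_graph_def cross_def cycle_graph_def)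

lemma bootstrap_step_iff_card:
  assumes "finite (pverts G)"
  shows "bootstrap_step G \<theta> \<omega> v \<longleftrightarrow>
    \<omega> v \<or> \<theta> \<le> card {w \<in> pverts G. (v, w) \<in> parcs G \<and> \<omega> w}"
proof -
  have "(\<Sum>w | w \<in> pverts G \<and> (v, w) \<in> parcs G. of_bool (\<omega> w)) =
    card {w \<in> {w. w \<in> pverts G \<and> (v, w) \<in> parcs G}. \<omega> w}"
    using assms by (subst sum_of_bool_eq) (auto simp: Int_def)
  then show ?thesis by (simp add: bootstrap_step_def conj_assoc)
qed

lemma bootstrap_iterate_mono:
  assumes "(bootstrap_step G \<theta> ^^ i) \<omega> v" "i \<le> j"
  shows "(bootstrap_step G \<theta> ^^ j) \<omega> v"
  using assms(2,1) by (induction rule: dec_induct) (auto simp: bootstrap_step_def)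

lemma initial_imp_final_occupied: "v \<in> pverts G \<Longrightarrow> \<omega> v \<Longrightarrow> v \<in> final_occupied G \<theta> \<omega>"
  unfolding mem_final_occupied_iff by (auto intro: exI[of _ 0])

text \<open>Each vertex of the finite set \<open>S\<close> is occupied from some time on; at the
  latest of these times, \<open>J\<close>, all of them count towards the threshold.\<close>

lemma final_occupied_closed:
  assumes "finite (pverts G)" "v \<in> pverts G" "S \<subseteq> final_occupied G \<theta> \<omega>"
    "\<And>w. w \<in> S \<Longrightarrow> (v, w) \<in> parcs G" "\<theta> \<le> card S"
  shows "v \<in> final_occupied G \<theta> \<omega>"
proof -
  have S: "S \<subseteq> pverts G" "\<forall>w\<in>S. \<exists>j. (bootstrap_step G \<theta> ^^ j) \<omega> w"
    using assms(3) by (auto simp: mem_final_occupied_iff)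
  then obtain j where j: "\<And>w. w \<in> S \<Longrightarrow> (bootstrap_step G \<theta> ^^ j w) \<omega> w" by metis
  have fin: "finite S" using S(1) assms(1) finite_subset by blast
  define J where "J = Max (j ` S)"
  have J: "(bootstrap_step G \<theta> ^^ J) \<omega> w" if "w \<in> S" for w
    using that fin by (intro bootstrap_iterate_mono[OF j[OF that]]) (auto simp: J_def)
  have "card S \<le> card {w \<in> pverts G. (v, w) \<in> parcs G \<and> (bootstrap_step G \<theta> ^^ J) \<omega> w}"
    using assms(1,4) S(1) J by (intro card_mono) auto
  then have "(bootstrap_step G \<theta> ^^ Suc J) \<omega> v"
    using assms(1,5) by (simp add: bootstrap_step_iff_card)
  then show ?thesis using assms(2) by (auto simp: mem_final_occupied_iff simp del: funpow.simps)
qed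

text \<open>Rows with index below \<open>s\<close> are kept apart: a row with \<open>l + 1\<close> occupied vertices, from
  which a layer fills up without outside help, is only sought among them, so that it does not
  contribute to the columns counted here.\<close>
definition good_layer :: "nat \<Rightarrow> nat \<Rightarrow> nat \<Rightarrow> nat \<Rightarrow> (nat \<times> nat \<times> nat \<Rightarrow> bool) \<Rightarrow> bool" where
  "good_layer l n s k \<omega> \<longleftrightarrow>
     2 * l + 1 \<le> card {x \<in> {s..<n}. l \<le> occ_count (grid_row k x {..<n}) \<omega>} \<and>
     2 * l + 1 \<le> card {y \<in> {..<n}. l \<le> occ_count (grid_col k {s..<n} y) \<omega>}"

definition has_seed :: "nat \<Rightarrow> nat \<Rightarrow> nat \<Rightarrow> nat \<Rightarrow> (nat \<times> nat \<times> nat \<Rightarrow> bool) \<Rightarrow> bool" where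
  "has_seed l n s k \<omega> \<longleftrightarrow> (\<exists>x<s. l + 1 \<le> occ_count (grid_row k x {..<n}) \<omega>)"

section \<open>Spreading of full layers\<close>

context
  fixes l m n s :: nat and \<omega> :: "nat \<times> nat \<times> nat \<Rightarrow> bool" and F :: "(nat \<times> nat \<times> nat) set"
  assumes s: "s \<le> n"
  defines "F \<equiv> final_occupied (layered_graph m n) (2 * l + 1) \<omega>"
begin

lemma layered_closed:
  assumes "k < m" "x < n" "y < n" "S \<subseteq> F"
    "S \<subseteq> cross n k x y \<union> {k'. (k, k') \<in> parcs (cycle_graph m)} \<times> {x} \<times> {y}" "2 * l + 1 \<le> card S"
  shows "(k, x, y) \<in> F"
  unfolding F_def
proof (rule final_occupied_closed)
  show "(k, x, y) \<in> pverts (layered_graph m n)" using assms by (simp add: pverts_layered_graph)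
  show "((k, x, y), w) \<in> parcs (layered_graph m n)" if "w \<in> S" for w
    using assms(5) that unfolding neighbours_layered_graph[OF assms(1-3), symmetric] by blast
qed (use assms in \<open>simp_all add: F_def pverts_layered_graph\<close>)

text \<open>Two rounds: a vertex in a row from \<open>R\<close> sees the occupied vertices over
  \<open>C\<close>, and then any vertex sees those of its column in the rows
  \<open>R\<close>.\<close>

lemma grid_fills_layer:
  assumes "k < m" "R \<subseteq> {..<n}" "C \<subseteq> {..<n}" "2 * l + 1 \<le> card R" "2 * l + 1 \<le> card C"
    and grid: "{k} \<times> R \<times> C \<subseteq> F"
  shows "layer n k \<subseteq> F"
proof -
  have rows: "(k, x, y) \<in> F" if "x \<in> R" "y < n" for x y
  proof (cases "y \<in> C")
    case True then show ?thesis using grid that by auto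
  next
    case False
    show ?thesis
      by (rule layered_closed[of _ _ _ "grid_row k x C"])
         (use assms that False in \<open>auto simp: cross_def card_cartesian_product\<close>)
  qed
  have "(k, x, y) \<in> F" if "x < n" "y < n" for x y
  proof (cases "x \<in> R")
    case True then show ?thesis using rows that by auto
  next
    case False
    show ?thesis
      by (rule layered_closed[of _ _ _ "grid_col k R y"])
         (use assms rows that False in \<open>auto simp: cross_def card_cartesian_product\<close>)
  qed
  then show ?thesis by auto
qed

lemma initial_subset_final: "k < m \<Longrightarrow> x < n \<Longrightarrow> y < n \<Longrightarrow> \<omega> (k, x, y) \<Longrightarrow> (k, x, y) \<in> F"
  unfolding F_def by (intro initial_imp_final_occupied) (auto simp: pverts_layered_graph)

text \<open>Adds up three disjoint sources of occupied neighbours: initial ones in the row, initial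
  ones in the part \<open>X\<close> of the column, and vertices \<open>T\<close> that may have
  become occupied later. Restricting the column to \<open>X\<close> keeps \<open>T\<close> from
  being counted twice.\<close>

lemma row_col_closed:
  assumes k: "k < m" "x < n" "y < n" and X: "X \<subseteq> {..<n}"
    and r: "a \<le> occ_count (grid_row k x {..<n}) \<omega>" and c: "b \<le> occ_count (grid_col k X y) \<omega>"
    and T: "T \<subseteq> F" "T \<subseteq> grid_col k ({..<n} - X - {x}) y \<union> {k'. (k, k') \<in> parcs (cycle_graph m)} \<times> {x} \<times> {y}"
      "finite T" "2 * l + 1 \<le> a + b + card T"
  shows "(k, x, y) \<in> F"
\<comment> \<open>The row and the column share only the vertex itself. When it is vacant, the sets
  \<open>A\<close> and \<open>B\<close> are disjoint and lie in its cross.\<close>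
proof (cases "\<omega> (k, x, y)")
  case True then show ?thesis using initial_subset_final k by blast
next
  case False
  define A where "A = {v \<in> grid_row k x {..<n}. \<omega> v}"
  define B where "B = {v \<in> grid_col k X y. \<omega> v}"
  have cyc: "(k, k) \<notin> parcs (cycle_graph m)" by (auto simp: cycle_graph_def)
  have fin: "finite A" "finite B" using X finite_subset[of X "{..<n}"] by (auto simp: A_def B_def)
  have "A \<inter> B = {}" "(A \<union> B) \<inter> T = {}"
    using False T(2) cyc by (auto simp: A_def B_def)
  then have "card (A \<union> B \<union> T) = card A + card B + card T"
    using fin T(3) by (simp add: card_Un_disjoint)
  moreover have "a \<le> card A" "b \<le> card B" using r c by (simp_all add: occ_count_def A_def B_def)
  ultimately have card: "2 * l + 1 \<le> card (A \<union> B \<union> T)" using T(4) by linarith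
  show ?thesis
  proof (rule layered_closed[OF k _ _ card])
    show "A \<union> B \<union> T \<subseteq> F"
      using T(1) initial_subset_final X k by (auto simp: A_def B_def)
    show "A \<union> B \<union> T \<subseteq> cross n k x y \<union> {k'. (k, k') \<in> parcs (cycle_graph m)} \<times> {x} \<times> {y}"
      using T(2) X False k unfolding A_def B_def cross_def by blast
  qed
qed

text \<open>At a crossing of a counted row and a counted column, \<open>l\<close> neighbours come
  from each line and one from the full layer \<open>k'\<close>, which makes
  \<open>2 * l + 1\<close>.\<close>

lemma good_layer_next_to_full:
  assumes "good_layer l n s k \<omega>" "k < m" "(k, k') \<in> parcs (cycle_graph m)" "layer n k' \<subseteq> F"
  shows "layer n k \<subseteq> F"
proof (rule grid_fills_layer)
  let ?R = "{x \<in> {s..<n}. l \<le> occ_count (grid_row k x {..<n}) \<omega>}"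
  let ?C = "{y \<in> {..<n}. l \<le> occ_count (grid_col k {s..<n} y) \<omega>}"
  show "2 * l + 1 \<le> card ?R" "2 * l + 1 \<le> card ?C" using assms(1) by (auto simp: good_layer_def)
  have "(k, x, y) \<in> F" if "x \<in> ?R" "y \<in> ?C" for x y
    by (rule row_col_closed[where X = "{s..<n}" and T = "{(k', x, y)}" and a = l and b = l])
       (use that assms in auto)
  then show "{k} \<times> ?R \<times> ?C \<subseteq> F" by auto
qed (use assms in auto)

lemma good_layer_with_seed:
  assumes "good_layer l n s k \<omega>" "k < m" "has_seed l n s k \<omega>"
  shows "layer n k \<subseteq> F"
proof (rule grid_fills_layer)
  let ?R = "{x \<in> {s..<n}. l \<le> occ_count (grid_row k x {..<n}) \<omega>}"
  let ?C = "{y \<in> {..<n}. l \<le> occ_count (grid_col k {s..<n} y) \<omega>}"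
  show "2 * l + 1 \<le> card ?R" "2 * l + 1 \<le> card ?C" using assms(1) by (auto simp: good_layer_def)
  obtain x0 where x0: "x0 < s" "l + 1 \<le> occ_count (grid_row k x0 {..<n}) \<omega>"
    using assms(3) by (auto simp: has_seed_def)
  \<comment> \<open>In the seed row, its \<open>l + 1\<close> vertices and the \<open>l\<close> of a
    counted column reach the threshold.\<close>
  have seed: "(k, x0, y) \<in> F" if "y \<in> ?C" for y
    by (rule row_col_closed[where X = "{s..<n}" and T = "{}" and a = "l + 1" and b = l])
       (use that assms x0 s in auto)
  \<comment> \<open>The vertex just filled in row \<open>x0\<close> now plays the part of the full
    neighbouring layer; as \<open>x0 < s\<close>, it is not among the vertices counted in the
    column.\<close>
  have "(k, x, y) \<in> F" if "x \<in> ?R" "y \<in> ?C" for x y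
    by (rule row_col_closed[where X = "{s..<n}" and T = "{(k, x0, y)}" and a = l and b = l])
       (use that assms x0 s seed in auto)
  then show "{k} \<times> ?R \<times> ?C \<subseteq> F" by auto
qed (use assms in auto)

end

lemma Suc_mod_neq: "2 \<le> m \<Longrightarrow> Suc i mod m \<noteq> i mod m"
  by (metis Suc_n_not_le_n le_refl mod_Suc mod_less_divisor n_not_Suc_n numeral_2_eq_2 order_less_le_trans zero_less_Suc)

lemma cycle_graph_arc_Suc:
  assumes "2 \<le> m"
  shows "(i mod m, Suc i mod m) \<in> parcs (cycle_graph m)" "(Suc i mod m, i mod m) \<in> parcs (cycle_graph m)"
  using assms Suc_mod_neq[OF assms, of i] by (auto simp: cycle_graph_def mod_Suc_eq)

text \<open>The seeded layer at offset \<open>i\<close> fills by itself, and the good layers before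
  it then fill one after another down to offset 0; hence the downward induction.\<close>

lemma good_window_fills:
  assumes "s \<le> n" "2 \<le> m" "k < m"
    and good: "\<And>i. i < N \<Longrightarrow> good_layer l n s ((k + i) mod m) \<omega>"
    and seed: "i < N" "has_seed l n s ((k + i) mod m) \<omega>"
  shows "layer n k \<subseteq> final_occupied (layered_graph m n) (2 * l + 1) \<omega>"
proof -
  have "layer n ((k + j) mod m) \<subseteq> final_occupied (layered_graph m n) (2 * l + 1) \<omega>" if "j \<le> i" for j
    using that
  proof (induction rule: inc_induct)
    case base
    show ?case using good_layer_with_seed[OF assms(1) good[OF seed(1)] _ seed(2)] assms(2) by simp
  next
    case (step j)
    show ?case
      by (rule good_layer_next_to_full[OF assms(1) good])
         (use step seed assms(2) cycle_graph_arc_Suc(1)[OF assms(2), of "k + j"] in auto)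
  qed
  from this[of 0] show ?thesis using assms by simp
qed

section \<open>Freezing between two blockers\<close>

lemma occ_count_cross:
  assumes "x < n" "y < n"
  shows "occ_count (cross n k x y) \<omega> \<le> occ_count (grid_row k x {..<n}) \<omega> + occ_count (grid_col k {..<n} y) \<omega>"
proof -
  have "occ_count (cross n k x y) \<omega> \<le> card ({v \<in> grid_row k x {..<n}. \<omega> v} \<union> {v \<in> grid_col k {..<n} y. \<omega> v})"
    unfolding occ_count_def by (rule card_mono) (auto simp: cross_def)
  also have "\<dots> \<le> occ_count (grid_row k x {..<n}) \<omega> + occ_count (grid_col k {..<n} y) \<omega>"
    unfolding occ_count_def by (rule card_Un_le)
  finally show ?thesis .
qed

text \<open>Only rows are restricted: with at most \<open>l\<close> occupied vertices per column,
  every cross of the layer then has fewer than \<open>2 * l\<close> of them.\<close>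

definition blocker :: "nat \<Rightarrow> nat \<Rightarrow> nat \<Rightarrow> (nat \<times> nat \<times> nat \<Rightarrow> bool) \<Rightarrow> bool" where
  "blocker l n k \<omega> \<longleftrightarrow> (\<forall>x<n. occ_count (grid_row k x {..<n}) \<omega> < l)"

definition short_lines :: "nat \<Rightarrow> nat \<Rightarrow> nat \<Rightarrow> (nat \<times> nat \<times> nat \<Rightarrow> bool) \<Rightarrow> bool" where
  "short_lines l n k \<omega> \<longleftrightarrow>
     (\<forall>x<n. occ_count (grid_row k x {..<n}) \<omega> \<le> l) \<and> (\<forall>y<n. occ_count (grid_col k {..<n} y) \<omega> \<le> l)"

text \<open>Below \<open>2 * l - 1\<close>, even two occupied neighbours in the cycle direction
  leave the total short of the threshold \<open>2 * l + 1\<close>.\<close>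

definition light_crosses :: "nat \<Rightarrow> nat \<Rightarrow> nat \<Rightarrow> nat \<Rightarrow> (nat \<times> nat \<times> nat \<Rightarrow> bool) \<Rightarrow> bool" where
  "light_crosses l n k k' \<omega> \<longleftrightarrow>
     (\<forall>x<n. \<forall>y<n. \<omega> (k', x, y) \<longrightarrow> occ_count (cross n k x y) \<omega> < 2 * l - 1)"

lemma cycle_graph_neighbours:
  assumes "2 \<le> m" "(Suc i mod m, k') \<in> parcs (cycle_graph m)"
  shows "k' = i mod m \<or> k' = Suc (Suc i) mod m"
proof -
  have "k' = i mod m" if "Suc k' mod m = Suc i mod m" "k' < m"
  proof -
    \<comment> \<open>Adding \<open>m - 1\<close> undoes the successor modulo
      \<open>m\<close>.\<close>
    have "(Suc k' + (m - 1)) mod m = (Suc i + (m - 1)) mod m"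
      using that by (intro mod_add_cong) auto
    then show ?thesis using assms(1) that by simp
  qed
  moreover have "k' < m" "k' = Suc (Suc i mod m) mod m \<or> Suc i mod m = Suc k' mod m"
    using assms(2) unfolding cycle_graph_def by auto
  ultimately show ?thesis unfolding mod_Suc_eq by metis
qed

lemma bootstrap_step_in_layer:
  assumes "k < m" "x < n" "y < n"
  shows "bootstrap_step (layered_graph m n) \<theta> \<omega> (k, x, y) \<longleftrightarrow> \<omega> (k, x, y) \<or>
    \<theta> \<le> occ_count (cross n k x y) \<omega> + card {k'. (k, k') \<in> parcs (cycle_graph m) \<and> \<omega> (k', x, y)}"
proof -
  let ?Z = "{k'. (k, k') \<in> parcs (cycle_graph m) \<and> \<omega> (k', x, y)}"
  have fin: "finite (cross n k x y)" "finite ?Z"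
    by (auto simp: cross_def cycle_graph_def)
  have cyc: "(k, k) \<notin> parcs (cycle_graph m)" by (auto simp: cycle_graph_def)
  have "{w \<in> pverts (layered_graph m n). ((k, x, y), w) \<in> parcs (layered_graph m n) \<and> \<omega> w} =
     {w \<in> {w \<in> pverts (layered_graph m n). ((k, x, y), w) \<in> parcs (layered_graph m n)}. \<omega> w}"
    by blast
  also have "\<dots> = {w \<in> cross n k x y. \<omega> w} \<union> (\<lambda>k'. (k', x, y)) ` ?Z"
    unfolding neighbours_layered_graph[OF assms] by auto
  finally have nbrs: "{w \<in> pverts (layered_graph m n). ((k, x, y), w) \<in> parcs (layered_graph m n) \<and> \<omega> w} =
    {w \<in> cross n k x y. \<omega> w} \<union> (\<lambda>k'. (k', x, y)) ` ?Z" .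
  have "card ({w \<in> cross n k x y. \<omega> w} \<union> (\<lambda>k'. (k', x, y)) ` ?Z) =
      occ_count (cross n k x y) \<omega> + card ((\<lambda>k'. (k', x, y)) ` ?Z)"
    unfolding occ_count_def using fin cyc by (intro card_Un_disjoint) (auto simp: cross_def)
  moreover have "card ((\<lambda>k'. (k', x, y)) ` ?Z) = card ?Z"
    by (intro card_image) (auto simp: inj_on_def)
  ultimately have card: "card {w \<in> pverts (layered_graph m n). ((k, x, y), w) \<in> parcs (layered_graph m n) \<and> \<omega> w} =
    occ_count (cross n k x y) \<omega> + card ?Z"
    unfolding nbrs by (rule trans[OF _ arg_cong[of _ _ "(+) _"]])
  have "finite (pverts (layered_graph m n))" by (simp add: pverts_layered_graph)
  note step = bootstrap_step_iff_card[OF this, of \<theta> \<omega> "(k, x, y)"]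
  show ?thesis unfolding step card by (rule refl)
qed

text \<open>By induction on time the window keeps its initial state whatever happens outside.
  Inside, an occupied neighbour in the cycle direction makes the cross light; without one, only the
  at most \<open>2 * l\<close> occupied vertices of the cross count. At an end layer the outer
  neighbour is uncontrolled, but the blocker leaves so few occupied vertices that the inner
  neighbour would have to be occupied too, and then the cross is light. Indices are reduced modulo
  \<open>m\<close> only where they are used, so the window may wrap around the cycle.\<close>

lemma frozen_between_blockers:
  assumes "1 \<le> l" "2 \<le> m" "i1 < i2"
    and blockers: "blocker l n (i1 mod m) \<omega>" "blocker l n (i2 mod m) \<omega>"
    and short: "\<And>i. i1 \<le> i \<Longrightarrow> i \<le> i2 \<Longrightarrow> short_lines l n (i mod m) \<omega>"
    and light: "\<And>i. i1 \<le> i \<Longrightarrow> i < i2 \<Longrightarrow> light_crosses l n (i mod m) (Suc i mod m) \<omega> \<and>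
      light_crosses l n (Suc i mod m) (i mod m) \<omega>"
    and i: "i1 \<le> i" "i \<le> i2" and xy: "x < n" "y < n"
  shows "(i mod m, x, y) \<in> final_occupied (layered_graph m n) (2 * l + 1) \<omega> \<longleftrightarrow> \<omega> (i mod m, x, y)"
proof -
  let ?B = "bootstrap_step (layered_graph m n) (2 * l + 1)"
  have "(?B ^^ j) \<omega> (i mod m, x, y) \<longleftrightarrow> \<omega> (i mod m, x, y)"
    if "i1 \<le> i" "i \<le> i2" "x < n" "y < n" for i j x y
    using that
  proof (induction j arbitrary: i x y)
    case (Suc j)
    define \<omega>' where "\<omega>' = (?B ^^ j) \<omega>"
    have IH: "\<omega>' (i mod m, x, y) \<longleftrightarrow> \<omega> (i mod m, x, y)"
      if "i1 \<le> i" "i \<le> i2" "x < n" "y < n" for i x y using Suc.IH[OF that] by (simp add: \<omega>'_def)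
    let ?k = "i mod m"
    let ?Z = "{k'. (?k, k') \<in> parcs (cycle_graph m) \<and> \<omega>' (k', x, y)}"
    let ?c = "occ_count (cross n ?k x y) \<omega>"
    have cross: "occ_count (cross n ?k x y) \<omega>' = ?c"
      unfolding occ_count_def using IH Suc.prems
      by (intro arg_cong[of _ _ card]) (auto simp: cross_def)
    have c: "?c \<le> occ_count (grid_row ?k x {..<n}) \<omega> + occ_count (grid_col ?k {..<n} y) \<omega>"
      using Suc.prems by (intro occ_count_cross)
    have c2: "?c \<le> 2 * l" using c short[of i] Suc.prems by (force simp: short_lines_def)
    \<comment> \<open>A predecessor of \<open>i\<close> modulo \<open>m\<close>, also for
      \<open>i = 0\<close>; for \<open>i1 < i\<close> it is the true predecessor and lies in the
      window.\<close>
    define p where "p = (if i = 0 then m - 1 else i - 1)"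
    have p: "Suc p mod m = ?k" "i1 < i \<Longrightarrow> Suc p = i"
      using \<open>2 \<le> m\<close> by (auto simp: p_def)
    have Suc_p: "Suc (Suc p) mod m = Suc i mod m" using p(1) by (metis mod_Suc_eq)
    have Z: "?Z \<subseteq> {p mod m, Suc i mod m}"
      using cycle_graph_neighbours[OF \<open>2 \<le> m\<close>, of p] unfolding p(1) Suc_p by blast
    have card_Z: "card ?Z \<le> card {p mod m, Suc i mod m}" using Z by (intro card_mono) auto
    also have "\<dots> \<le> 2" by (simp add: card_insert_if)
    finally have Z2: "card ?Z \<le> 2" .
    \<comment> \<open>A neighbour in the window that is occupied now was so initially, by the
      induction hypothesis, hence the cross is light.\<close>
    have up: "?c < 2 * l - 1" if "i < i2" "Suc i mod m \<in> ?Z"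
      using light[of i] that Suc.prems IH[of "Suc i" x y] by (auto simp: light_crosses_def)
    have down: "?c < 2 * l - 1" if "i1 < i" "p mod m \<in> ?Z"
      using light[of p] that Suc.prems IH[of p x y] p by (auto simp: light_crosses_def)
    have "\<not> 2 * l + 1 \<le> ?c + card ?Z"
    proof
      assume *: "2 * l + 1 \<le> ?c + card ?Z"
      \<comment> \<open>The cycle contributes at most two, so the cross is not light, and by
        \<open>up\<close> and \<open>down\<close> no neighbour within the window is
        occupied.\<close>
      then have heavy: "\<not> ?c < 2 * l - 1" using Z2 \<open>1 \<le> l\<close> by linarith
      consider "i = i1" | "i = i2" | "i1 < i" "i < i2" using Suc.prems by linarith
      then show False
      proof cases
        assume "i1 < i" "i < i2"
        then have "?Z = {}" using up down heavy Z by blast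
        then have "card ?Z = 0" by (simp only: card.empty)
        then show False using * c2 by linarith
      next
        \<comment> \<open>The blocker forces two distinct occupied cycle neighbours, yet only the
          outer one, \<open>p mod m\<close>, can be occupied.\<close>
        assume i: "i = i1"
        then have "?c < 2 * l"
          using c blockers(1) short[of i] Suc.prems by (force simp: blocker_def short_lines_def)
        then have "card ?Z = 2" using * Z2 by linarith
        moreover have "?Z \<subseteq> {p mod m}" using Z up heavy i assms(3) by blast
        ultimately show False using card_mono[of "{p mod m}" ?Z] by simp
      next
        assume i: "i = i2"
        then have "?c < 2 * l"
          using c blockers(2) short[of i] Suc.prems by (force simp: blocker_def short_lines_def)
        then have "card ?Z = 2" using * Z2 by linarith
        moreover have "?Z \<subseteq> {Suc i mod m}" using Z down heavy i assms(3) by blast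
        ultimately show False using card_mono[of "{Suc i mod m}" ?Z] by simp
      qed
    qed
    then show ?case
      using bootstrap_step_in_layer[of ?k m x n y "2 * l + 1" \<omega>'] \<open>2 \<le> m\<close> Suc.prems IH cross
      by (simp add: \<omega>'_def)
  qed simp
  with i xy assms(2) show ?thesis
    by (auto simp: mem_final_occupied_iff pverts_layered_graph)
qed

section \<open>Probability estimates for fixed \<open>m\<close> and \<open>n\<close>\<close>

abbreviation vertex_box :: "nat \<Rightarrow> nat \<Rightarrow> (nat \<times> nat \<times> nat) set" where
  "vertex_box m n \<equiv> {..<m} \<times> {..<n} \<times> {..<n}"

lemma field_prob_mono:
  "(\<And>\<omega>. \<omega> \<in> A \<Longrightarrow> \<omega> \<in> B) \<Longrightarrow> field_prob V p A \<le> field_prob V p B"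
  by (intro measure_pmf.finite_measure_mono) auto

lemma field_prob_Un_le: "field_prob V p (A \<union> B) \<le> field_prob V p A + field_prob V p B"
  by (rule measure_Un_le) auto

lemma field_prob_UN_le_const:
  fixes c :: real
  assumes "finite I" "\<And>i. i \<in> I \<Longrightarrow> field_prob V p (E i) \<le> c"
  shows "field_prob V p (\<Union>i\<in>I. E i) \<le> card I * c"
proof -
  have "field_prob V p (\<Union>i\<in>I. E i) \<le> (\<Sum>i\<in>I. field_prob V p (E i))"
    by (rule field_prob_UN_le[OF assms(1)])
  also have "\<dots> \<le> (\<Sum>i\<in>I. c)" by (rule sum_mono) (rule assms(2))
  finally show ?thesis by simp
qed

lemma choose_right_mono: "m \<le> n \<Longrightarrow> m choose k \<le> n choose k"
proof (induction rule: dec_induct)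
  case (step n)
  have "n choose k \<le> Suc n choose k" by (cases k) simp_all
  with step.IH show ?case by linarith
qed simp

text \<open>Uniform over sets with between \<open>r\<close> and \<open>n\<close> elements, so that
  full rows and truncated columns share one constant.\<close>

lemma field_prob_occ_count_ge_lower:
  fixes p :: real
  assumes "finite V" "A \<subseteq> V" "p \<in> {0..1}" "j \<le> r" "r \<le> card A" "card A \<le> n"
  shows "(r choose j) * p ^ j * (1 - p) ^ n \<le> field_prob V p {\<omega>. j \<le> occ_count A \<omega>}"
proof -
  have "(r choose j) * p ^ j * (1 - p) ^ n \<le> (card A choose j) * p ^ j * (1 - p) ^ (card A - j)"
    using assms by (intro mult_mono power_decreasing) (auto intro: choose_right_mono)
  also have "\<dots> \<le> field_prob V p {\<omega>. j \<le> occ_count A \<omega>}"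
    using assms by (intro field_prob_occ_count_ge_ge) auto
  finally show ?thesis .
qed

lemma choose_mult_power_le:
  fixes p :: real
  assumes "0 \<le> p"
  shows "(n choose j) * p ^ j \<le> (n * p) ^ j / fact j"
proof -
  have "real (n choose j) * fact j \<le> real n ^ j"
    using binomial_fact_pow[of n j] by (metis of_nat_fact of_nat_le_iff of_nat_mult of_nat_power)
  then have "real (n choose j) \<le> real n ^ j / fact j" by (simp add: field_simps)
  then show ?thesis
    using assms mult_right_mono[of "real (n choose j)" "real n ^ j / fact j" "p ^ j"]
    by (simp add: power_mult_distrib)
qed

lemma field_prob_occ_count_ge_upper:
  fixes p :: real
  assumes "finite V" "A \<subseteq> V" "p \<in> {0..1}"
  shows "field_prob V p {\<omega>. j \<le> occ_count A \<omega>} \<le> (card A * p) ^ j / fact j"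
  using field_prob_occ_count_ge_le[OF assms(1,2), of "{}" p j] choose_mult_power_le[of p "card A" j] assms(3)
  by simp

text \<open>Two offsets differ by less than \<open>m\<close>, hence not by a multiple of it.
  Distinct layers provide the disjoint sets of vertices that independence requires.\<close>

lemma inj_on_add_mod: "N \<le> m \<Longrightarrow> inj_on (\<lambda>i. (k + i) mod m) {..<N}" for k m N :: nat
proof (rule linorder_inj_onI)
  fix i j assume "N \<le> m" "i < j" "i \<in> {..<N}" "j \<in> {..<N}"
  then show "(k + i) mod m \<noteq> (k + j) mod m"
    using mod_eq_dvd_iff_nat[of "k + i" "k + j" m] by (auto dest: dvd_imp_le)
qed auto

text \<open>Rows are disjoint from each other, and so are columns, so the Chernoff bound applies to
  each family; the two families overlap and are combined by a union bound, hence the factor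
  2.\<close>

lemma prob_not_good_layer:
  fixes p t :: real
  assumes k: "k < m" and p: "p \<in> {0..1}" and s: "s \<le> n" "l \<le> n - s" and t: "0 < t" "t < 1"
  defines "q \<equiv> (n - s choose l) * p ^ l * (1 - p) ^ n"
  shows "field_prob (vertex_box m n) p {\<omega>. \<not> good_layer l n s k \<omega>} \<le>
    2 * (exp (- (1 - t) * (q * real (n - s))) / t ^ (2 * l + 1))"
proof -
  have q0: "0 \<le> q" using p by (simp add: q_def)
  have "field_prob (vertex_box m n) p {\<omega>. card {x \<in> {s..<n}. l \<le> occ_count (grid_row k x {..<n}) \<omega>} < 2 * l + 1} \<le>
     exp (- (1 - t) * (q * card {s..<n})) / t ^ (2 * l + 1)"
  proof (rule field_prob_few_events[OF _ _ _ _ _ _ t])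
    show "disjoint_family_on (\<lambda>x. grid_row k x {..<n}) {s..<n}" by (auto simp: disjoint_family_on_def)
    show "depends_on (grid_row k x {..<n}) (\<lambda>\<omega>. l \<le> occ_count (grid_row k x {..<n}) \<omega>)" for x
      by (rule depends_on_occ_count) simp
    fix x assume "x \<in> {s..<n}"
    then show "q \<le> field_prob (vertex_box m n) p {\<omega>. l \<le> occ_count (grid_row k x {..<n}) \<omega>}"
      unfolding q_def using k s p
      by (intro field_prob_occ_count_ge_lower) (auto simp: card_cartesian_product)
  qed (use k in auto)
  also have "card {s..<n} = n - s" by simp
  finally have 1: "field_prob (vertex_box m n) p {\<omega>. card {x \<in> {s..<n}. l \<le> occ_count (grid_row k x {..<n}) \<omega>} < 2 * l + 1} \<le>
     exp (- (1 - t) * (q * real (n - s))) / t ^ (2 * l + 1)" .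
  have "field_prob (vertex_box m n) p {\<omega>. card {y \<in> {..<n}. l \<le> occ_count (grid_col k {s..<n} y) \<omega>} < 2 * l + 1} \<le>
     exp (- (1 - t) * (q * card {..<n})) / t ^ (2 * l + 1)"
  proof (rule field_prob_few_events[OF _ _ _ _ _ _ t])
    show "disjoint_family_on (\<lambda>y. grid_col k {s..<n} y) {..<n}" by (auto simp: disjoint_family_on_def)
    show "depends_on (grid_col k {s..<n} y) (\<lambda>\<omega>. l \<le> occ_count (grid_col k {s..<n} y) \<omega>)" for y
      by (rule depends_on_occ_count) simp
    fix y assume "y \<in> {..<n}"
    then show "q \<le> field_prob (vertex_box m n) p {\<omega>. l \<le> occ_count (grid_col k {s..<n} y) \<omega>}"
      unfolding q_def using k s p
      by (intro field_prob_occ_count_ge_lower) (auto simp: card_cartesian_product)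
  qed (use k in auto)
  \<comment> \<open>There are \<open>n\<close> columns but only \<open>n - s\<close> rows; the
    smaller number serves for both.\<close>
  also have "\<dots> \<le> exp (- (1 - t) * (q * real (n - s))) / t ^ (2 * l + 1)"
    using t q0 by (intro divide_right_mono) (auto intro!: mult_left_mono)
  finally have 2: "field_prob (vertex_box m n) p {\<omega>. card {y \<in> {..<n}. l \<le> occ_count (grid_col k {s..<n} y) \<omega>} < 2 * l + 1} \<le>
     exp (- (1 - t) * (q * real (n - s))) / t ^ (2 * l + 1)" .
  have "{\<omega>. \<not> good_layer l n s k \<omega>} =
      {\<omega>. card {x \<in> {s..<n}. l \<le> occ_count (grid_row k x {..<n}) \<omega>} < 2 * l + 1} \<union>
      {\<omega>. card {y \<in> {..<n}. l \<le> occ_count (grid_col k {s..<n} y) \<omega>} < 2 * l + 1}"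
    by (auto simp: good_layer_def not_le)
  then show ?thesis
    using order_trans[OF field_prob_Un_le add_mono[OF 1 2]] by simp
qed

text \<open>Chernoff's bound with \<open>k = 1\<close> and \<open>t = 1 / 2\<close> over the
  \<open>N * s\<close> rows that may be seeds; this choice gives the factor 2 and the halved
  exponent.\<close>

lemma prob_no_seed:
  fixes N :: nat and p q :: real
  assumes N: "N \<le> m" "0 < m" and p: "p \<in> {0..1}" and s: "s \<le> n" "l + 1 \<le> n"
  defines "q \<equiv> (n choose (l + 1)) * p ^ (l + 1) * (1 - p) ^ n"
  shows "field_prob (vertex_box m n) p {\<omega>. \<forall>i<N. \<not> has_seed l n s ((k + i) mod m) \<omega>} \<le>
    2 * exp (- (q * (N * s)) / 2)"
proof -
  let ?R = "\<lambda>(i, x). grid_row ((k + i) mod m) x {..<n}"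
  let ?I = "{..<N} \<times> {..<s}"
  have "field_prob (vertex_box m n) p {\<omega>. card {z \<in> ?I. l + 1 \<le> occ_count (?R z) \<omega>} < 1} \<le>
     exp (- (1 - 1 / 2) * (q * card ?I)) / (1 / 2) ^ 1"
  proof (rule field_prob_few_events)
    show "disjoint_family_on ?R ?I"
      using inj_on_add_mod[OF N(1), of k] by (auto simp: disjoint_family_on_def inj_on_def)
    show "depends_on (?R z) (\<lambda>\<omega>. l + 1 \<le> occ_count (?R z) \<omega>)" for z
      by (rule depends_on_occ_count) simp
    fix z assume "z \<in> ?I"
    then show "q \<le> field_prob (vertex_box m n) p {\<omega>. l + 1 \<le> occ_count (?R z) \<omega>}"
      unfolding q_def using N s p
      by (intro field_prob_occ_count_ge_lower) (auto simp: card_cartesian_product)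
  qed (use N s in auto)
  also have "\<dots> = 2 * exp (- (q * (N * s)) / 2)" by (simp add: field_simps)
  also have "{\<omega>. card {z \<in> ?I. l + 1 \<le> occ_count (?R z) \<omega>} < 1} =
      {\<omega>. \<forall>i<N. \<not> has_seed l n s ((k + i) mod m) \<omega>}"
    by (auto simp: has_seed_def)
  finally show ?thesis .
qed

text \<open>If the vertex stays vacant, some layer of the window starting at \<open>k\<close> is not
  good or none has a seed. The parameter \<open>t\<close> stays free; it is later chosen small
  enough for \<open>(1 - t) * c\<close> to exceed \<open>h\<close>.\<close>

lemma prob_not_full:
  fixes N :: nat and p t :: real
  assumes k: "k < m" and xy: "x < n" "y < n" and N: "N \<le> m" "2 \<le> m" and p: "p \<in> {0..1}"
    and s: "l + 1 \<le> n - s" and t: "0 < t" "t < 1"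
  shows "field_prob (vertex_box m n) p {\<omega>. (k, x, y) \<notin> final_occupied (layered_graph m n) (2 * l + 1) \<omega>} \<le>
    N * (2 * (exp (- (1 - t) * ((n - s choose l) * p ^ l * (1 - p) ^ n * real (n - s))) / t ^ (2 * l + 1))) +
    2 * exp (- ((n choose (l + 1)) * p ^ (l + 1) * (1 - p) ^ n * (N * s)) / 2)"
proof -
  let ?F = "\<lambda>\<omega>. final_occupied (layered_graph m n) (2 * l + 1) \<omega>"
  let ?B = "\<Union>i\<in>{..<N}. {\<omega>. \<not> good_layer l n s ((k + i) mod m) \<omega>}"
  let ?S = "{\<omega>. \<forall>i<N. \<not> has_seed l n s ((k + i) mod m) \<omega>}"
  have s': "s \<le> n" "l \<le> n - s" "l + 1 \<le> n" using s by auto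
  have "\<omega> \<in> ?B \<union> ?S" if "(k, x, y) \<notin> ?F \<omega>" for \<omega>
  proof (rule ccontr)
    assume "\<omega> \<notin> ?B \<union> ?S"
    then obtain i where "i < N" "has_seed l n s ((k + i) mod m) \<omega>"
      "\<And>j. j < N \<Longrightarrow> good_layer l n s ((k + j) mod m) \<omega>" by auto
    with good_window_fills[OF s'(1) N(2) k, of N l \<omega> i] that xy show False by auto
  qed
  then have "field_prob (vertex_box m n) p {\<omega>. (k, x, y) \<notin> ?F \<omega>} \<le> field_prob (vertex_box m n) p (?B \<union> ?S)"
    by (intro field_prob_mono) auto
  also have "\<dots> \<le> field_prob (vertex_box m n) p ?B + field_prob (vertex_box m n) p ?S"
    by (rule field_prob_Un_le)
  also have "field_prob (vertex_box m n) p ?B \<le> card {..<N} *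
      (2 * (exp (- (1 - t) * ((n - s choose l) * p ^ l * (1 - p) ^ n * real (n - s))) / t ^ (2 * l + 1)))"
    by (rule field_prob_UN_le_const, simp, rule prob_not_good_layer) (use k p s' t in auto)
  also have "field_prob (vertex_box m n) p ?S \<le>
      2 * exp (- ((n choose (l + 1)) * p ^ (l + 1) * (1 - p) ^ n * (N * s)) / 2)"
    using N by (intro prob_no_seed p s') auto
  finally show ?thesis by simp
qed

text \<open>The rows of one layer are independent, and each is bounded by a union bound. The
  hypothesis \<open>Q\<close> keeps the factors nonnegative, so that their product is
  monotone.\<close>

lemma prob_blocker_ge:
  fixes p :: real
  assumes k: "k < m" and p: "p \<in> {0..1}" and Q: "(n * p) ^ l / fact l \<le> 1"
  shows "(1 - (n * p) ^ l / fact l) ^ n \<le> field_prob (vertex_box m n) p {\<omega>. blocker l n k \<omega>}"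
proof -
  have "(1 - (n * p) ^ l / fact l) ^ n = (\<Prod>x\<in>{..<n}. 1 - (n * p) ^ l / fact l)" by simp
  also have "\<dots> \<le> (\<Prod>x\<in>{..<n}. field_prob (vertex_box m n) p {\<omega>. occ_count (grid_row k x {..<n}) \<omega> < l})"
  proof (rule prod_mono, intro conjI)
    fix x assume "x \<in> {..<n}"
    then have le: "field_prob (vertex_box m n) p {\<omega>. l \<le> occ_count (grid_row k x {..<n}) \<omega>} \<le> (n * p) ^ l / fact l"
      using field_prob_occ_count_ge_upper[of "vertex_box m n" "grid_row k x {..<n}" p l] k p
      by (auto simp: card_cartesian_product)
    have "{\<omega>. occ_count (grid_row k x {..<n}) \<omega> < l} =
       space (measure_pmf (bernoulli_field (vertex_box m n) p)) - {\<omega>. l \<le> occ_count (grid_row k x {..<n}) \<omega>}"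
      by auto
    then have "field_prob (vertex_box m n) p {\<omega>. occ_count (grid_row k x {..<n}) \<omega> < l} =
        1 - field_prob (vertex_box m n) p {\<omega>. l \<le> occ_count (grid_row k x {..<n}) \<omega>}"
      using measure_pmf.prob_compl[of "{\<omega>. l \<le> occ_count (grid_row k x {..<n}) \<omega>}" "bernoulli_field (vertex_box m n) p"]
      by simp
    with le show "1 - (n * p) ^ l / fact l \<le> field_prob (vertex_box m n) p {\<omega>. occ_count (grid_row k x {..<n}) \<omega> < l}"
      by simp
  qed (use Q in simp)
  also have "\<dots> = field_prob (vertex_box m n) p {\<omega>. \<forall>x\<in>{..<n}. occ_count (grid_row k x {..<n}) \<omega> < l}"
  proof (rule field_prob_INT[symmetric])
    show "disjoint_family_on (\<lambda>x. grid_row k x {..<n}) {..<n}" by (auto simp: disjoint_family_on_def)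
    show "depends_on (grid_row k x {..<n}) (\<lambda>\<omega>. occ_count (grid_row k x {..<n}) \<omega> < l)" for x
      by (rule depends_on_occ_count) simp
  qed (use k in auto)
  also have "{\<omega>. \<forall>x\<in>{..<n}. occ_count (grid_row k x {..<n}) \<omega> < l} = {\<omega>. blocker l n k \<omega>}"
    by (auto simp: blocker_def)
  finally show ?thesis .
qed

text \<open>Blockers in distinct layers are independent; again Chernoff's bound with
  \<open>k = 1\<close> and \<open>t = 1 / 2\<close>.\<close>

lemma prob_no_blocker:
  fixes N :: nat and p :: real
  assumes N: "N \<le> m" "0 < m" and p: "p \<in> {0..1}" and Q: "(n * p) ^ l / fact l \<le> 1"
  shows "field_prob (vertex_box m n) p {\<omega>. \<forall>i<N. \<not> blocker l n ((k + i) mod m) \<omega>} \<le>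
    2 * exp (- ((1 - (n * p) ^ l / fact l) ^ n * N) / 2)"
proof -
  let ?L = "\<lambda>i. layer n ((k + i) mod m)" and ?P = "\<lambda>i. blocker l n ((k + i) mod m)"
  have "field_prob (vertex_box m n) p {\<omega>. card {i \<in> {..<N}. ?P i \<omega>} < 1} \<le>
     exp (- (1 - 1 / 2) * ((1 - (n * p) ^ l / fact l) ^ n * card {..<N})) / (1 / 2) ^ 1"
  proof (rule field_prob_few_events)
    show "disjoint_family_on ?L {..<N}"
      using inj_on_add_mod[OF N(1), of k] by (auto simp: disjoint_family_on_def inj_on_def)
    show "depends_on (?L i) (?P i)" for i
      unfolding blocker_def depends_on_def occ_count_def
    proof (intro allI impI)
      fix \<omega> \<omega>' :: "nat \<times> nat \<times> nat \<Rightarrow> bool"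
      assume "\<forall>v\<in>?L i. \<omega> v = \<omega>' v"
      then have "{v \<in> grid_row ((k + i) mod m) x {..<n}. \<omega> v} = {v \<in> grid_row ((k + i) mod m) x {..<n}. \<omega>' v}"
        if "x < n" for x using that by auto
      then show "(\<forall>x<n. card {v \<in> grid_row ((k + i) mod m) x {..<n}. \<omega> v} < l) =
        (\<forall>x<n. card {v \<in> grid_row ((k + i) mod m) x {..<n}. \<omega>' v} < l)" by simp
    qed
    show "(1 - (n * p) ^ l / fact l) ^ n \<le> field_prob (vertex_box m n) p {\<omega>. ?P i \<omega>}" for i
      using N by (intro prob_blocker_ge p Q) auto
  qed (use N in auto)
  also have "\<dots> = 2 * exp (- ((1 - (n * p) ^ l / fact l) ^ n * N) / 2)" by (simp add: field_simps)
  also have "{\<omega>. card {i \<in> {..<N}. ?P i \<omega>} < 1} = {\<omega>. \<forall>i<N. \<not> ?P i \<omega>}"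
    by auto
  finally show ?thesis .
qed

text \<open>Union bound over the \<open>2 * n\<close> lines of the layer; the factorial is dropped,
  as only the power of \<open>n * p\<close> matters.\<close>

lemma prob_not_short_lines:
  fixes p :: real
  assumes k: "k < m" and p: "p \<in> {0..1}"
  shows "field_prob (vertex_box m n) p {\<omega>. \<not> short_lines l n k \<omega>} \<le> 2 * (real n * (n * p) ^ (l + 1))"
proof -
  let ?R = "\<Union>x\<in>{..<n}. {\<omega>. l + 1 \<le> occ_count (grid_row k x {..<n}) \<omega>}"
  let ?C = "\<Union>y\<in>{..<n}. {\<omega>. l + 1 \<le> occ_count (grid_col k {..<n} y) \<omega>}"
  have fact: "(n * p) ^ (l + 1) / fact (l + 1) \<le> (n * p) ^ (l + 1)"
    using p mult_left_mono[OF fact_ge_1[of "l + 1", where ?'a = real], of "(n * p) ^ (l + 1)"]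
    by (simp add: divide_le_eq del: fact_Suc power_Suc add_Suc_right)
  have "{\<omega>. \<not> short_lines l n k \<omega>} = ?R \<union> ?C" by (force simp: short_lines_def not_le Suc_le_eq)
  then have "field_prob (vertex_box m n) p {\<omega>. \<not> short_lines l n k \<omega>} \<le>
      field_prob (vertex_box m n) p ?R + field_prob (vertex_box m n) p ?C"
    by (simp only: field_prob_Un_le)
  also have "field_prob (vertex_box m n) p ?R \<le> card {..<n} * (n * p) ^ (l + 1)"
  proof (rule field_prob_UN_le_const)
    fix x assume "x \<in> {..<n}"
    then have "field_prob (vertex_box m n) p {\<omega>. l + 1 \<le> occ_count (grid_row k x {..<n}) \<omega>} \<le>
        (card (grid_row k x {..<n}) * p) ^ (l + 1) / fact (l + 1)"
      using k p by (intro field_prob_occ_count_ge_upper) auto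
    also have "card (grid_row k x {..<n}) = n" by (simp add: card_cartesian_product)
    finally show "field_prob (vertex_box m n) p {\<omega>. l + 1 \<le> occ_count (grid_row k x {..<n}) \<omega>} \<le> (n * p) ^ (l + 1)"
      using fact by linarith
  qed simp
  also have "field_prob (vertex_box m n) p ?C \<le> card {..<n} * (n * p) ^ (l + 1)"
  proof (rule field_prob_UN_le_const)
    fix y assume "y \<in> {..<n}"
    then have "field_prob (vertex_box m n) p {\<omega>. l + 1 \<le> occ_count (grid_col k {..<n} y) \<omega>} \<le>
        (card (grid_col k {..<n} y) * p) ^ (l + 1) / fact (l + 1)"
      using k p by (intro field_prob_occ_count_ge_upper) auto
    also have "card (grid_col k {..<n} y) = n" by (simp add: card_cartesian_product)
    finally show "field_prob (vertex_box m n) p {\<omega>. l + 1 \<le> occ_count (grid_col k {..<n} y) \<omega>} \<le> (n * p) ^ (l + 1)"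
      using fact by linarith
  qed simp
  finally show ?thesis by (simp only: mult_2 card_lessThan)
qed

text \<open>Union bound over \<open>n ^ 2\<close> positions: \<open>2 * l - 1\<close> occupied
  vertices in the cross and one in layer \<open>k'\<close> cost \<open>p ^ (2 * l)\<close>, against
  at most \<open>(2 * n) ^ (2 * l - 1)\<close> choices.\<close>

lemma prob_not_light_crosses:
  fixes p :: real
  assumes k: "k < m" "k' < m" "k \<noteq> k'" and p: "p \<in> {0..1}" and l: "1 \<le> l"
  shows "field_prob (vertex_box m n) p {\<omega>. \<not> light_crosses l n k k' \<omega>} \<le> 4 ^ l * real n * (n * p) ^ (2 * l)"
proof -
  let ?E = "\<lambda>(x, y). {\<omega>. (\<forall>v\<in>{(k', x, y)}. \<omega> v) \<and> 2 * l - 1 \<le> occ_count (cross n k x y) \<omega>}"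
  have "{\<omega>. \<not> light_crosses l n k k' \<omega>} = (\<Union>z\<in>{..<n} \<times> {..<n}. ?E z)"
    by (auto simp: light_crosses_def not_less)
  also have "field_prob (vertex_box m n) p \<dots> \<le>
      card ({..<n} \<times> {..<n}) * ((2 * n) ^ (2 * l - 1) * p ^ (2 * l - 1 + 1))"
  proof (rule field_prob_UN_le_const)
    fix z assume "z \<in> {..<n} \<times> {..<n}"
    then obtain x y where z: "z = (x, y)" "x < n" "y < n" by auto
    have "card (cross n k x y) \<le> card (grid_row k x ({..<n} - {y})) + card (grid_col k ({..<n} - {x}) y)"
      unfolding cross_def by (rule card_Un_le)
    also have "\<dots> \<le> 2 * n" using z by (simp add: card_cartesian_product)
    finally have card: "card (cross n k x y) \<le> 2 * n" .
    have "field_prob (vertex_box m n) p (?E z) \<le>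
        (card (cross n k x y) choose (2 * l - 1)) * p ^ (2 * l - 1 + card {(k', x, y)})"
      unfolding z case_prod_conv
      by (rule field_prob_occ_count_ge_le) (use k z p in \<open>auto simp: cross_def\<close>)
    also have "real (card (cross n k x y) choose (2 * l - 1)) \<le> real ((2 * n) ^ (2 * l - 1))"
      by (intro of_nat_mono order_trans[OF choose_right_mono[OF card]]
          order_trans[OF _ binomial_fact_pow]) simp
    finally show "field_prob (vertex_box m n) p (?E z) \<le> (2 * n) ^ (2 * l - 1) * p ^ (2 * l - 1 + 1)"
      using p by (simp add: mult_right_mono)
  qed simp
  also have "\<dots> = 2 ^ (2 * l - 1) * real n * (n * p) ^ (2 * l)"
    using l by (cases l) (simp_all add: card_cartesian_product power_mult_distrib algebra_simps)
  also have "\<dots> \<le> 2 ^ (2 * l) * real n * (n * p) ^ (2 * l)"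
    by (intro mult_right_mono power_increasing) (use p in auto)
  finally show ?thesis by (simp add: power_mult)
qed

text \<open>A window of \<open>N\<close> layers on each side of layer \<open>k\<close> is searched
  for a blocker. Outside the events \<open>?E1\<close> to \<open>?E5\<close> the vertex is frozen
  between two blockers, so it can only be occupied from the start, which accounts for the summand
  \<open>p\<close>.\<close>

lemma prob_final_occupied_le:
  fixes N :: nat and p :: real
  assumes k: "k < m" and xy: "x < n" "y < n" and N: "N \<le> m" "2 \<le> m" and p: "p \<in> {0..1}"
    and l: "1 \<le> l" and Q: "(n * p) ^ l / fact l \<le> 1"
  shows "field_prob (vertex_box m n) p {\<omega>. (k, x, y) \<in> final_occupied (layered_graph m n) (2 * l + 1) \<omega>} \<le>
    p + 4 * exp (- ((1 - (n * p) ^ l / fact l) ^ n * N) / 2) +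
    (2 * real N + 1) * (2 * (real n * (n * p) ^ (l + 1))) + 4 * real N * (4 ^ l * real n * (n * p) ^ (2 * l))"
proof -
  let ?P = "field_prob (vertex_box m n) p"
  let ?F = "\<lambda>\<omega>. final_occupied (layered_graph m n) (2 * l + 1) \<omega>"
  \<comment> \<open>The first layer of the left window. Layer \<open>k\<close> is represented by
    \<open>k + m\<close>, so that \<open>N \<le> m\<close> makes the subtraction exact.\<close>
  define b where "b = k + m - N"
  have mod_neq: "Suc i mod m \<noteq> i mod m" "i mod m \<noteq> Suc i mod m" for i
    using Suc_mod_neq[OF N(2), of i] by (blast, metis)
  let ?E0 = "{\<omega>. \<forall>v\<in>{(k, x, y)}. \<omega> v}"
  let ?E1 = "{\<omega>. \<forall>i<N. \<not> blocker l n ((b + i) mod m) \<omega>}"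
  let ?E2 = "{\<omega>. \<forall>i<N. \<not> blocker l n ((Suc (k + m) + i) mod m) \<omega>}"
  \<comment> \<open>Offsets 0 to \<open>2 * N\<close> comprise both windows and layer
    \<open>k\<close>; the \<open>2 * N\<close> consecutive pairs are used in both directions
    below.\<close>
  let ?E3 = "\<Union>i\<in>{..<2 * N + 1}. {\<omega>. \<not> short_lines l n ((b + i) mod m) \<omega>}"
  let ?E4 = "\<Union>i\<in>{..<2 * N}. {\<omega>. \<not> light_crosses l n ((b + i) mod m) (Suc (b + i) mod m) \<omega>}"
  let ?E5 = "\<Union>i\<in>{..<2 * N}. {\<omega>. \<not> light_crosses l n (Suc (b + i) mod m) ((b + i) mod m) \<omega>}"
  have "\<omega> \<in> ?E0 \<union> ?E1 \<union> ?E2 \<union> ?E3 \<union> ?E4 \<union> ?E5" if F: "(k, x, y) \<in> ?F \<omega>" for \<omega>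
  proof (rule ccontr)
    assume not: "\<omega> \<notin> ?E0 \<union> ?E1 \<union> ?E2 \<union> ?E3 \<union> ?E4 \<union> ?E5"
    then obtain i j where ij: "i < N" "j < N" "blocker l n ((b + i) mod m) \<omega>"
      "blocker l n ((Suc (k + m) + j) mod m) \<omega>" by blast
    have short: "short_lines l n ((b + i) mod m) \<omega>" if "i < 2 * N + 1" for i
      using not that by blast
    have light: "light_crosses l n ((b + i) mod m) (Suc (b + i) mod m) \<omega>"
      "light_crosses l n (Suc (b + i) mod m) ((b + i) mod m) \<omega>" if "i < 2 * N" for i
      using not that by blast+
    have window: "i' - b < 2 * N + 1" "b + (i' - b) = i'" if "b + i \<le> i'" "i' \<le> Suc (k + m) + j" for i'
      using that ij N unfolding b_def by linarith+
    have "((k + m) mod m, x, y) \<in> ?F \<omega> \<longleftrightarrow> \<omega> ((k + m) mod m, x, y)"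
    proof (rule frozen_between_blockers[OF l N(2) _ ij(3,4)])
      show "b + i < Suc (k + m) + j" "b + i \<le> k + m" using ij N by (auto simp: b_def)
      show "short_lines l n (i' mod m) \<omega>" if "b + i \<le> i'" "i' \<le> Suc (k + m) + j" for i'
        using short[OF window(1)[OF that]] window(2)[OF that] by simp
      show "light_crosses l n (i' mod m) (Suc i' mod m) \<omega> \<and> light_crosses l n (Suc i' mod m) (i' mod m) \<omega>"
        if "b + i \<le> i'" "i' < Suc (k + m) + j" for i'
      proof -
        have "i' - b < 2 * N" "b + (i' - b) = i'" using that ij N unfolding b_def by linarith+
        then show ?thesis using light[of "i' - b"] by simp
      qed
    qed (use xy in auto)
    with F not k show False by simp
  qed
  then have "?P {\<omega>. (k, x, y) \<in> ?F \<omega>} \<le> ?P (?E0 \<union> ?E1 \<union> ?E2 \<union> ?E3 \<union> ?E4 \<union> ?E5)"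
    by (intro field_prob_mono) auto
  also have "\<dots> \<le> ?P ?E0 + ?P ?E1 + ?P ?E2 + ?P ?E3 + ?P ?E4 + ?P ?E5"
    by (intro order_trans[OF field_prob_Un_le] add_mono order_refl)
  also have "?P ?E0 = p"
    using field_prob_all_occupied[of "vertex_box m n" "{(k, x, y)}" p] k xy p by simp
  also have "?P ?E1 \<le> 2 * exp (- ((1 - (n * p) ^ l / fact l) ^ n * N) / 2)"
    using N by (intro prob_no_blocker p Q) auto
  also have "?P ?E2 \<le> 2 * exp (- ((1 - (n * p) ^ l / fact l) ^ n * N) / 2)"
    using N by (intro prob_no_blocker p Q) auto
  also have "?P ?E3 \<le> card {..<2 * N + 1} * (2 * (real n * (n * p) ^ (l + 1)))"
    by (rule field_prob_UN_le_const, simp, rule prob_not_short_lines) (use N p in auto)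
  also have "?P ?E4 \<le> card {..<2 * N} * (4 ^ l * real n * (n * p) ^ (2 * l))"
    by (rule field_prob_UN_le_const, simp, rule prob_not_light_crosses)
       (rule mod_less_divisor mod_neq p l | use N in linarith)+
  also have "?P ?E5 \<le> card {..<2 * N} * (4 ^ l * real n * (n * p) ^ (2 * l))"
    by (rule field_prob_UN_le_const, simp, rule prob_not_light_crosses)
       (rule mod_less_divisor mod_neq p l | use N in linarith)+
  finally show ?thesis by (simp add: algebra_simps)
qed

section \<open>From vertex probabilities to densities\<close>

lemma prob_fraction_gt:
  fixes e \<delta> :: real
  assumes V: "finite V" "V \<noteq> {}" and A: "\<And>\<omega>. A \<omega> \<subseteq> V"
    and e: "\<And>v. v \<in> V \<Longrightarrow> field_prob V p {\<omega>. v \<in> A \<omega>} \<le> e" and \<delta>: "\<delta> > 0"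
  shows "field_prob V p {\<omega>. real (card (A \<omega>)) / real (card V) > \<delta>} \<le> e / \<delta>"
proof -
  have V0: "card V > 0" using V by (simp add: card_gt_0_iff)
  have card: "real (card (A \<omega>)) = (\<Sum>v\<in>V. indicator {\<omega>. v \<in> A \<omega>} \<omega>)" for \<omega>
    using A[of \<omega>] V(1) by (simp add: indicator_def sum.If_cases Int_absorb1 Int_def[symmetric])
  have "field_prob V p {\<omega>. real (card (A \<omega>)) / real (card V) > \<delta>} \<le>
      field_prob V p {\<omega> \<in> space (bernoulli_field V p). \<delta> \<le> real (card (A \<omega>)) / real (card V)}"
    by (intro field_prob_mono) auto
  also have "\<dots> \<le> field_expectation V p (\<lambda>\<omega>. real (card (A \<omega>)) / real (card V)) / \<delta>"
    by (rule integral_Markov_inequality_measure) (use V \<delta> in auto)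
  \<comment> \<open>By linearity the expected density is the average of the vertex probabilities, so
    a bound uniform in the vertex controls it.\<close>
  also have "field_expectation V p (\<lambda>\<omega>. real (card (A \<omega>)) / real (card V)) = (\<Sum>v\<in>V. field_prob V p {\<omega>. v \<in> A \<omega>}) / card V"
    unfolding card using V(1) by (simp add: Bochner_Integration.integral_sum)
  also have "\<dots> \<le> (\<Sum>v\<in>V. e) / card V"
    by (intro divide_right_mono sum_mono e) auto
  also have "\<dots> = e" using V0 by simp
  finally show ?thesis using \<delta> by (simp add: divide_right_mono)
qed

lemma tendsto_fraction_in_prob:
  fixes e :: "nat \<Rightarrow> real"
  assumes A: "\<And>n \<omega>. A n \<omega> \<subseteq> V n"
    and ev: "\<forall>\<^sub>F n in sequentially. finite (V n) \<and> V n \<noteq> {} \<and>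
      (\<forall>v\<in>V n. field_prob (V n) (p n) {\<omega>. v \<in> A n \<omega>} \<le> e n)"
    and e: "e \<longlonglongrightarrow> 0" and \<delta>: "\<delta> > 0"
  shows "(\<lambda>n. field_prob (V n) (p n) {\<omega>. real (card (A n \<omega>)) / real (card (V n)) > \<delta>}) \<longlonglongrightarrow> 0"
proof (rule tendsto_sandwich[OF _ _ tendsto_const])
  show "(\<lambda>n. e n / \<delta>) \<longlonglongrightarrow> 0" using tendsto_divide[OF e tendsto_const[of \<delta>]] \<delta> by simp
  show "\<forall>\<^sub>F n in sequentially. field_prob (V n) (p n) {\<omega>. real (card (A n \<omega>)) / real (card (V n)) > \<delta>} \<le> e n / \<delta>"
    using ev by eventually_elim (auto intro!: prob_fraction_gt A \<delta>)
qed simp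

lemma scarceI:
  fixes e :: "nat \<Rightarrow> real"
  assumes "\<And>n \<omega>. A n \<omega> \<subseteq> V n"
    and "\<forall>\<^sub>F n in sequentially. finite (V n) \<and> V n \<noteq> {} \<and>
      (\<forall>v\<in>V n. field_prob (V n) (p n) {\<omega>. v \<in> A n \<omega>} \<le> e n)"
    and "e \<longlonglongrightarrow> 0"
  shows "scarce (\<lambda>n. bernoulli_field (V n) (p n)) V A"
  using tendsto_fraction_in_prob[OF assms] by (simp add: scarce_def tendsto_const_in_prob_def)

text \<open>The vacant set has small density by the same argument, and its density is the distance
  from 1 of the density of \<open>A\<close>.\<close>

lemma abundantI:
  fixes e :: "nat \<Rightarrow> real"
  assumes A: "\<And>n \<omega>. A n \<omega> \<subseteq> V n"
    and ev: "\<forall>\<^sub>F n in sequentially. finite (V n) \<and> V n \<noteq> {} \<and>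
      (\<forall>v\<in>V n. field_prob (V n) (p n) {\<omega>. v \<notin> A n \<omega>} \<le> e n)"
    and e: "e \<longlonglongrightarrow> 0"
  shows "abundant (\<lambda>n. bernoulli_field (V n) (p n)) V A"
  unfolding abundant_def tendsto_const_in_prob_def
proof (intro allI impI)
  fix \<delta> :: real assume \<delta>: "\<delta> > 0"
  have "(\<lambda>n. field_prob (V n) (p n) {\<omega>. real (card (V n - A n \<omega>)) / real (card (V n)) > \<delta>}) \<longlonglongrightarrow> 0"
  proof (rule tendsto_fraction_in_prob[OF _ _ e \<delta>])
    show "\<forall>\<^sub>F n in sequentially. finite (V n) \<and> V n \<noteq> {} \<and>
      (\<forall>v\<in>V n. field_prob (V n) (p n) {\<omega>. v \<in> V n - A n \<omega>} \<le> e n)"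
      using ev by eventually_elim auto
  qed auto
  moreover have "\<forall>\<^sub>F n in sequentially. field_prob (V n) (p n) {\<omega>. real (card (V n - A n \<omega>)) / real (card (V n)) > \<delta>} =
    measure (bernoulli_field (V n) (p n)) {\<omega> \<in> space (bernoulli_field (V n) (p n)).
      \<bar>real (card (A n \<omega>)) / real (card (V n)) - 1\<bar> > \<delta>}"
    using ev
  proof eventually_elim
    case (elim n)
    have "real (card (V n - A n \<omega>)) / real (card (V n)) = \<bar>real (card (A n \<omega>)) / real (card (V n)) - 1\<bar>" for \<omega>
    proof -
      have "card (A n \<omega>) \<le> card (V n)" "finite (A n \<omega>)" "card (V n) > 0"
        using elim A[of n \<omega>] by (auto intro: card_mono finite_subset simp: card_gt_0_iff)
      then show ?thesis
        using card_Diff_subset[OF _ A[of n \<omega>]] by (simp add: of_nat_diff field_simps)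
    qed
    then show ?case by simp
  qed
  ultimately show "(\<lambda>n. measure (bernoulli_field (V n) (p n)) {\<omega> \<in> space (bernoulli_field (V n) (p n)).
      \<bar>real (card (A n \<omega>)) / real (card (V n)) - 1\<bar> > \<delta>}) \<longlonglongrightarrow> 0"
    by (rule Lim_transform_eventually)
qed

section \<open>Asymptotics at the critical density\<close>

lemma choose_div_power_tendsto: "(\<lambda>n. real (n choose j) / real n ^ j) \<longlonglongrightarrow> 1 / fact j"
proof (induction j)
  case (Suc j)
  have "(\<lambda>n. real (n choose j) / real n ^ j * ((real n - real j) / real n / real (Suc j))) \<longlonglongrightarrow>
     1 / fact j * (1 / real (Suc j))"
    by (intro tendsto_mult Suc.IH tendsto_divide tendsto_const) (real_asymp, simp)
  moreover have "\<forall>\<^sub>F n in sequentially.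
     real (n choose j) / real n ^ j * ((real n - real j) / real n / real (Suc j)) = real (n choose Suc j) / real n ^ Suc j"
    using eventually_ge_at_top[of "Suc j"]
  proof eventually_elim
    case (elim n)
    \<comment> \<open>Both sides equal \<open>n * (n - 1 choose j)\<close>.\<close>
    have "Suc j * (n choose Suc j) = (n - j) * (n choose j)"
      by (simp only: binomial_absorption binomial_absorb_comp)
    then have "real (Suc j) * real (n choose Suc j) = (real n - real j) * real (n choose j)"
      using elim by (metis Suc_leD of_nat_diff of_nat_mult)
    then have "real (n choose Suc j) = (real n - real j) * real (n choose j) / real (Suc j)"
      by (simp add: field_simps del: of_nat_Suc)
    then show ?case by (simp add: mult_ac del: of_nat_Suc)
  qed
  ultimately show ?case by (simp add: tendsto_cong mult.commute)
qed simp

locale critical_density =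
  fixes l :: nat and a :: real and p :: "nat \<Rightarrow> real"
  assumes l: "1 \<le> l" and a: "0 < a" and p01: "p n \<in> {0..1}"
    and p_asymp: "p \<sim>[sequentially]
      (\<lambda>n. a * (ln (real n) powr (1 / real l) / real n powr (1 + 1 / real l)))"
begin

text \<open>The density in units of its critical order. Splitting it off leaves explicit functions
  of \<open>n\<close> in the limits below.\<close>

definition X :: "nat \<Rightarrow> real" where
  "X n = p n / (ln (real n) powr (1 / real l) / real n powr (1 + 1 / real l))"

text \<open>The order of \<open>n * p n\<close>, namely the \<open>l\<close>-th root of
  \<open>ln n / n\<close>.\<close>

definition w :: "nat \<Rightarrow> real" where
  "w n = ln (real n) powr (1 / real l) * real n powr (- (1 / real l))"

lemma X_tendsto: "X \<longlonglongrightarrow> a"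
proof -
  let ?g = "\<lambda>n. ln (real n) powr (1 / real l) / real n powr (1 + 1 / real l)"
  have "\<forall>\<^sub>F n in sequentially. p n \<noteq> 0 \<or> a * ?g n \<noteq> 0"
    using eventually_ge_at_top[of 2] by eventually_elim (use a in auto)
  then have "(\<lambda>n. p n / (a * ?g n)) \<longlonglongrightarrow> 1"
    by (rule asymp_equivD_strong[OF p_asymp])
  then have "(\<lambda>n. a * (p n / (a * ?g n))) \<longlonglongrightarrow> a * 1" by (intro tendsto_mult tendsto_const)
  moreover have "(\<lambda>n. a * (p n / (a * ?g n))) = X" using a by (simp add: X_def fun_eq_iff)
  ultimately show ?thesis by simp
qed

lemma np_eq: "\<forall>\<^sub>F n in sequentially. real n * p n = X n * w n"
  using eventually_ge_at_top[of 2]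
proof eventually_elim
  case (elim n)
  then have "real n powr (1 + 1 / real l) = real n * real n powr (1 / real l)" by (simp add: powr_add)
  then show ?case using elim by (simp add: X_def w_def powr_minus field_simps)
qed

lemma w_power: "\<forall>\<^sub>F n in sequentially. w n ^ l = ln (real n) / real n"
  using eventually_ge_at_top[of 2]
proof eventually_elim
  case (elim n)
  have "(x powr (1 / real l)) ^ l = x" if "x > 0" for x
    using l that by (simp add: powr_power)
  from this[of "ln (real n)"] this[of "real n"] elim show ?case
    by (simp add: w_def power_mult_distrib powr_minus power_inverse divide_inverse)
qed

lemma np_tendsto: "(\<lambda>n. real n * p n) \<longlonglongrightarrow> 0"
proof -
  have "w \<longlonglongrightarrow> 0" unfolding w_def[abs_def] using l by real_asymp
  from tendsto_mult[OF X_tendsto this] have "(\<lambda>n. X n * w n) \<longlonglongrightarrow> 0" by simp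
  then show ?thesis using np_eq by (rule Lim_transform_eventually[OF _ eventually_mono]) simp
qed

text \<open>To leading order, \<open>n * (n * p n) ^ l / fact l\<close> is the expected number of
  rows of a layer with \<open>l\<close> occupied vertices: about \<open>c ln n\<close>.\<close>

lemma np_power_tendsto: "(\<lambda>n. real n * (real n * p n) ^ l / ln (real n)) \<longlonglongrightarrow> a ^ l"
proof -
  have "\<forall>\<^sub>F n in sequentially. X n ^ l = real n * (real n * p n) ^ l / ln (real n)"
    using np_eq w_power eventually_ge_at_top[of 2]
    by eventually_elim (simp add: power_mult_distrib)
  with tendsto_power[OF X_tendsto] show ?thesis by (rule Lim_transform_eventually)
qed

lemma np_power_Suc_eq:
  "\<forall>\<^sub>F n in sequentially. real n * (real n * p n) ^ (l + 1) = X n ^ (l + 1) * (ln (real n) * w n)"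
  using np_eq w_power eventually_ge_at_top[of 2]
  by eventually_elim (simp add: power_mult_distrib)

text \<open>Up to logarithms, \<open>n * (n * p n) ^ (l + 1)\<close> has order \<open>n\<close> to
  the power \<open>- 1 / l\<close>. So for \<open>h < 1 / l\<close> lines with \<open>l + 1\<close>
  occupied vertices are unlikely in the whole window.\<close>

lemma np_power_Suc_tendsto_0:
  assumes "h < 1 / real l"
  shows "(\<lambda>n. real n powr h * (real n * (real n * p n) ^ (l + 1))) \<longlonglongrightarrow> 0"
proof -
  have "0 < 1 / real l" using l by simp
  with assms have "(\<lambda>n. real n powr h * (ln (real n) * w n)) \<longlonglongrightarrow> 0"
    unfolding w_def by real_asymp
  from tendsto_mult[OF tendsto_power[OF X_tendsto, of "l + 1"] this]
  have "(\<lambda>n. X n ^ (l + 1) * (real n powr h * (ln (real n) * w n))) \<longlonglongrightarrow> 0" by simp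
  then show ?thesis
    by (rule Lim_transform_eventually) (use np_power_Suc_eq in eventually_elim, simp add: mult_ac)
qed

text \<open>The factor \<open>n / ln n\<close> is the number of rows per layer in which seeds are
  sought. Up to a factor with a positive limit, the product is
  \<open>n powr h * w n\<close>.\<close>

lemma np_power_Suc_at_top:
  assumes "h > 1 / real l"
  shows "filterlim (\<lambda>n. real n powr h * (real n / ln (real n)) * (real n * p n) ^ (l + 1)) at_top sequentially"
proof -
  have "0 < 1 / real l" using l by simp
  with assms have "filterlim (\<lambda>n. real n powr h * w n) at_top sequentially"
    unfolding w_def by real_asymp
  from filterlim_tendsto_pos_mult_at_top[OF tendsto_power[OF X_tendsto, of "l + 1"] _ this] a
  have "filterlim (\<lambda>n. X n ^ (l + 1) * (real n powr h * w n)) at_top sequentially" by simp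
  moreover have "\<forall>\<^sub>F n in sequentially. X n ^ (l + 1) * (real n powr h * w n) =
      real n powr h * (real n / ln (real n)) * (real n * p n) ^ (l + 1)"
    using np_power_Suc_eq eventually_ge_at_top[of 2]
  proof eventually_elim
    case (elim n)
    have "real n powr h * (real n / ln (real n)) * (real n * p n) ^ (l + 1) =
      real n powr h / ln (real n) * (real n * (real n * p n) ^ (l + 1))" by simp
    also have "\<dots> = X n ^ (l + 1) * (real n powr h * w n)"
      unfolding elim(1) using elim(2) by simp
    finally show ?case by simp
  qed
  ultimately show ?thesis by (simp add: filterlim_cong)
qed

end

lemma floor_powr_bounds:
  assumes "h > 0"
  shows "\<forall>\<^sub>F n in sequentially. 1 \<le> real (nat \<lfloor>real n powr h\<rfloor>) \<and>
    real (nat \<lfloor>real n powr h\<rfloor>) \<le> real n powr h \<and> real n powr h / 2 \<le> real (nat \<lfloor>real n powr h\<rfloor>)"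
proof -
  have "filterlim (\<lambda>n. real n powr h) at_top sequentially" using assms by real_asymp
  then have "\<forall>\<^sub>F n in sequentially. 2 \<le> real n powr h" by (simp add: filterlim_at_top)
  then show ?thesis
  proof eventually_elim
    case (elim n)
    have "2 \<le> \<lfloor>real n powr h\<rfloor>" using elim by (simp add: le_floor_iff)
    moreover have "real n powr h < \<lfloor>real n powr h\<rfloor> + 1" "\<lfloor>real n powr h\<rfloor> \<le> real n powr h" by linarith+
    ultimately show ?case by (simp add: field_simps)
  qed
qed

lemma exp_minus_half_tendsto_0:
  fixes f :: "'a \<Rightarrow> real"
  assumes "filterlim f at_top F"
  shows "((\<lambda>x. exp (- f x / 2)) \<longlongrightarrow> 0) F"
proof -
  have "((\<lambda>y :: real. exp (- y / 2)) \<longlongrightarrow> 0) at_top" by real_asymp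
  from filterlim_compose[OF this assms] show ?thesis .
qed

context critical_density
begin

text \<open>The lower bound of \<open>prob_blocker_ge\<close>.\<close>

definition no_row_bound :: "nat \<Rightarrow> real" where
  "no_row_bound n = (1 - (real n * p n) ^ l / fact l) ^ n"

lemma row_prob_tendsto_0: "(\<lambda>n. (real n * p n) ^ l / fact l) \<longlonglongrightarrow> 0"
proof -
  have "(\<lambda>n. (real n * p n) ^ l / fact l) \<longlonglongrightarrow> 0 ^ l / fact l"
    by (intro tendsto_intros np_tendsto) simp
  moreover have "(0 :: real) ^ l / fact l = 0" using l by (simp add: power_0_left)
  ultimately show ?thesis by (simp only:)
qed

text \<open>With \<open>Q\<close> the bound for one row, \<open>n * Q n\<close> is about
  \<open>c ln n\<close> and \<open>Q\<close> tends to 0, so \<open>n * ln (1 - Q n)\<close> is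
  eventually at least \<open>- b * ln n\<close>.\<close>

lemma no_row_bound_ge:
  assumes "a ^ l / fact l < b"
  shows "\<forall>\<^sub>F n in sequentially. real n powr (- b) \<le> no_row_bound n"
proof -
  define Q where "Q = (\<lambda>n. (real n * p n) ^ l / fact l)"
  have Q0: "Q \<longlonglongrightarrow> 0" unfolding Q_def by (rule row_prob_tendsto_0)
  \<comment> \<open>The factor \<open>1 + 2 * Q n\<close> anticipates the estimate
    \<open>ln (1 - x) \<ge> - x - 2 * x ^ 2\<close> used below.\<close>
  have "(\<lambda>n. real n * (real n * p n) ^ l / ln (real n) / fact l * (1 + 2 * Q n)) \<longlonglongrightarrow> a ^ l / fact l * (1 + 2 * 0)"
    by (intro tendsto_intros np_power_tendsto Q0) simp
  then have "\<forall>\<^sub>F n in sequentially. real n * (real n * p n) ^ l / ln (real n) / fact l * (1 + 2 * Q n) < b"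
    using assms by (intro order_tendstoD) auto
  moreover have "\<forall>\<^sub>F n in sequentially. Q n < 1 / 2"
    by (rule order_tendstoD[OF Q0]) simp
  ultimately show ?thesis using eventually_ge_at_top[of 2]
  proof eventually_elim
    case (elim n)
    have L: "0 < ln (real n)" using elim by simp
    have Qn: "0 \<le> Q n" using p01[of n] by (simp add: Q_def)
    have "real n * Q n * (1 + 2 * Q n) / ln (real n) < b"
      using elim(1) by (simp add: Q_def field_simps)
    then have le: "real n * (Q n + 2 * (Q n)\<^sup>2) \<le> b * ln (real n)"
      using L by (simp add: pos_divide_less_eq power2_eq_square algebra_simps)
    have "- Q n - 2 * (Q n)\<^sup>2 \<le> ln (1 - Q n)"
      using Qn elim(2) by (intro ln_one_minus_pos_lower_bound) auto
    then have "real n * (- Q n - 2 * (Q n)\<^sup>2) \<le> real n * ln (1 - Q n)" by (intro mult_left_mono) auto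
    with le have "- b * ln (real n) \<le> real n * ln (1 - Q n)" by (simp add: algebra_simps)
    then have "exp (- b * ln (real n)) \<le> exp (real n * ln (1 - Q n))" by simp
    also have "exp (real n * ln (1 - Q n)) = (1 - Q n) ^ n"
      using elim(2) by (simp add: exp_of_nat_mult)
    finally show ?case using elim(3) by (simp add: no_row_bound_def Q_def powr_def)
  qed
qed

text \<open>The window contains on average at least about \<open>n powr (h - b)\<close> blockers,
  which diverges as \<open>b < h\<close>; long lines and heavy crosses are excluded by
  \<open>h < 1 / l\<close>.\<close>

lemma scarce_error_tendsto_0:
  assumes "a ^ l / fact l < b" "b < h" "h < 1 / real l"
  defines "N \<equiv> \<lambda>n. nat \<lfloor>real n powr h\<rfloor>"
  shows "(\<lambda>n. p n + 4 * exp (- (no_row_bound n * N n) / 2) +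
    (2 * real (N n) + 1) * (2 * (real n * (real n * p n) ^ (l + 1))) +
    4 * real (N n) * (4 ^ l * real n * (real n * p n) ^ (2 * l))) \<longlonglongrightarrow> 0"
proof -
  have h: "0 < h" "b < h" using assms a by (auto intro: le_less_trans[of 0 b] less_trans[of 0 "a ^ l / fact l"])
  have N: "\<forall>\<^sub>F n in sequentially. 1 \<le> real (N n) \<and> real (N n) \<le> real n powr h \<and> real n powr h / 2 \<le> real (N n)"
    unfolding N_def by (rule floor_powr_bounds[OF h(1)])
  note small = np_power_Suc_tendsto_0[OF assms(3)]
  have "(\<lambda>n. p n) \<longlonglongrightarrow> 0"
  proof (rule tendsto_sandwich[OF _ _ tendsto_const np_tendsto])
    show "\<forall>\<^sub>F n in sequentially. 0 \<le> p n" using p01 by simp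
    show "\<forall>\<^sub>F n in sequentially. p n \<le> real n * p n"
      using eventually_ge_at_top[of 1]
    proof eventually_elim
      case (elim n)
      then show ?case using mult_right_mono[of 1 "real n" "p n"] p01[of n] by simp
    qed
  qed
  moreover have "(\<lambda>n. exp (- (no_row_bound n * N n) / 2)) \<longlonglongrightarrow> 0"
  proof -
    have "filterlim (\<lambda>n. real n powr (- b) * (real n powr h / 2)) at_top sequentially"
      using h by real_asymp
    moreover have "\<forall>\<^sub>F n in sequentially. real n powr (- b) * (real n powr h / 2) \<le> no_row_bound n * N n"
      using no_row_bound_ge[OF assms(1)] N 
    proof eventually_elim
      case (elim n)
      then show ?case using order_trans[OF powr_ge_zero elim(1)] by (intro mult_mono) auto
    qed
    ultimately have "filterlim (\<lambda>n. no_row_bound n * N n) at_top sequentially"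
      by (rule filterlim_at_top_mono)
    then show ?thesis by (rule exp_minus_half_tendsto_0)
  qed
  moreover have "(\<lambda>n. (2 * real (N n) + 1) * (2 * (real n * (real n * p n) ^ (l + 1)))) \<longlonglongrightarrow> 0"
  proof (rule tendsto_sandwich[OF _ _ tendsto_const])
    \<comment> \<open>\<open>N n \<ge> 1\<close> gives
      \<open>2 * N n + 1 \<le> 3 * n powr h\<close>, whence the constant 6.\<close>
    show "(\<lambda>n. 6 * (real n powr h * (real n * (real n * p n) ^ (l + 1)))) \<longlonglongrightarrow> 0"
      using tendsto_mult[OF tendsto_const small, of 6] by simp
    show "\<forall>\<^sub>F n in sequentially. (2 * real (N n) + 1) * (2 * (real n * (real n * p n) ^ (l + 1))) \<le>
        6 * (real n powr h * (real n * (real n * p n) ^ (l + 1)))"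
      using N
    proof eventually_elim
      case (elim n)
      have "(2 * real (N n) + 1) * (2 * (real n * (real n * p n) ^ (l + 1))) \<le>
          (3 * real n powr h) * (2 * (real n * (real n * p n) ^ (l + 1)))"
        using elim p01[of n] by (intro mult_right_mono) auto
      then show ?case by simp
    qed
    show "\<forall>\<^sub>F n in sequentially. 0 \<le> (2 * real (N n) + 1) * (2 * (real n * (real n * p n) ^ (l + 1)))"
      using p01 by simp
  qed
  moreover have "(\<lambda>n. 4 * real (N n) * (4 ^ l * real n * (real n * p n) ^ (2 * l))) \<longlonglongrightarrow> 0"
  proof (rule tendsto_sandwich[OF _ _ tendsto_const])
    show "(\<lambda>n. 4 * 4 ^ l * (real n powr h * (real n * (real n * p n) ^ (l + 1)))) \<longlonglongrightarrow> 0"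
      using tendsto_mult[OF tendsto_const small, of "4 * 4 ^ l"] by simp
    have "\<forall>\<^sub>F n in sequentially. real n * p n < 1" by (rule order_tendstoD[OF np_tendsto]) simp
    then show "\<forall>\<^sub>F n in sequentially. 4 * real (N n) * (4 ^ l * real n * (real n * p n) ^ (2 * l)) \<le>
        4 * 4 ^ l * (real n powr h * (real n * (real n * p n) ^ (l + 1)))"
      using N
    proof eventually_elim
      case (elim n)
      \<comment> \<open>As \<open>l + 1 \<le> 2 * l\<close> and \<open>n * p n < 1\<close>, the
        bound for heavy crosses reduces to the one for long lines.\<close>
      have "(real n * p n) ^ (2 * l) \<le> (real n * p n) ^ (l + 1)"
        using elim p01[of n] l by (intro power_decreasing) auto
      then have "4 * real (N n) * (4 ^ l * real n * (real n * p n) ^ (2 * l)) \<le>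
         4 * real n powr h * (4 ^ l * real n * (real n * p n) ^ (l + 1))"
        using elim p01[of n] by (intro mult_mono) auto
      then show ?case by (simp add: mult_ac)
    qed
    show "\<forall>\<^sub>F n in sequentially. 0 \<le> 4 * real (N n) * (4 ^ l * real n * (real n * p n) ^ (2 * l))"
      using p01 by simp
  qed
  ultimately show ?thesis
    by (rule tendsto_add_zero[OF tendsto_add_zero[OF tendsto_add_zero[OF _ tendsto_mult_right_zero]]])
qed

text \<open>A compromise: \<open>o(n)\<close> rows, so that setting them apart does not change the
  constant \<open>c\<close> for the remaining lines, yet enough of them that the supply of seeds
  shrinks only by a logarithm.\<close>

definition spare_rows :: "nat \<Rightarrow> nat" where
  "spare_rows n = nat \<lfloor>real n / ln (real n)\<rfloor>"

definition crowded_bound :: "nat \<Rightarrow> real" where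
  "crowded_bound n = (n - spare_rows n choose l) * p n ^ l * (1 - p n) ^ n"

lemma spare_rows_tendsto:
  "(\<lambda>n. real (spare_rows n) / (real n / ln (real n))) \<longlonglongrightarrow> 1"
  "(\<lambda>n. real (spare_rows n) / real n) \<longlonglongrightarrow> 0"
proof -
  have eq: "\<forall>\<^sub>F n in sequentially. real_of_int \<lfloor>real n / ln (real n)\<rfloor> = real (spare_rows n)"
    using eventually_ge_at_top[of 2] by eventually_elim (auto simp: spare_rows_def)
  have "(\<lambda>n. real_of_int \<lfloor>real n / ln (real n)\<rfloor> / (real n / ln (real n))) \<longlonglongrightarrow> 1"
    "(\<lambda>n. real_of_int \<lfloor>real n / ln (real n)\<rfloor> / real n) \<longlonglongrightarrow> 0"
    by real_asymp+
  note lims = this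
  show "(\<lambda>n. real (spare_rows n) / (real n / ln (real n))) \<longlonglongrightarrow> 1"
    by (rule Lim_transform_eventually[OF lims(1)]) (use eq in eventually_elim, simp)
  show "(\<lambda>n. real (spare_rows n) / real n) \<longlonglongrightarrow> 0"
    by (rule Lim_transform_eventually[OF lims(2)]) (use eq in eventually_elim, simp)
qed

lemma spare_rows_le: "\<forall>\<^sub>F n in sequentially. spare_rows n \<le> n"
proof -
  have "\<forall>\<^sub>F n in sequentially. real (spare_rows n) / real n < 1"
    by (rule order_tendstoD[OF spare_rows_tendsto(2)]) simp
  then show ?thesis using eventually_ge_at_top[of 1] by eventually_elim simp
qed

lemma ratio_rows_tendsto: "(\<lambda>n. real (n - spare_rows n) / real n) \<longlonglongrightarrow> 1"
proof -
  have "(\<lambda>n. 1 - real (spare_rows n) / real n) \<longlonglongrightarrow> 1 - 0"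
    by (intro tendsto_intros spare_rows_tendsto)
  moreover have "\<forall>\<^sub>F n in sequentially. 1 - real (spare_rows n) / real n = real (n - spare_rows n) / real n"
    using spare_rows_le eventually_ge_at_top[of 1] by eventually_elim (simp add: of_nat_diff field_simps)
  ultimately show ?thesis by (simp add: tendsto_cong)
qed

lemma rows_at_top: "filterlim (\<lambda>n. n - spare_rows n) at_top sequentially"
proof -
  have "filterlim (\<lambda>n. real (n - spare_rows n) / real n * real n) at_top sequentially"
    by (rule filterlim_tendsto_pos_mult_at_top[OF ratio_rows_tendsto]) (simp_all add: filterlim_real_sequentially)
  moreover have "\<forall>\<^sub>F n in sequentially. real (n - spare_rows n) / real n * real n = real (n - spare_rows n)"
    using eventually_ge_at_top[of 1] by eventually_elim simp
  ultimately have "filterlim (\<lambda>n. real (n - spare_rows n)) at_top sequentially"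
    by (simp add: filterlim_cong)
  then show ?thesis by (simp add: filterlim_sequentially_iff_filterlim_real)
qed

lemma vacant_line_tendsto: "(\<lambda>n. (1 - p n) ^ n) \<longlonglongrightarrow> 1"
proof (rule tendsto_sandwich[OF _ _ _ tendsto_const])
  show "(\<lambda>n. 1 - real n * p n) \<longlonglongrightarrow> 1" using tendsto_diff[OF tendsto_const np_tendsto, of 1] by simp
  show "\<forall>\<^sub>F n in sequentially. 1 - real n * p n \<le> (1 - p n) ^ n"
  proof (rule always_eventually, rule allI)
    fix n show "1 - real n * p n \<le> (1 - p n) ^ n"
      using Bernoulli_inequality[of "- p n" n] p01[of n] by simp
  qed
  show "\<forall>\<^sub>F n in sequentially. (1 - p n) ^ n \<le> 1"
    using p01 by (intro always_eventually allI power_le_one) auto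
qed

lemma crowded_bound_tendsto:
  "(\<lambda>n. crowded_bound n * real (n - spare_rows n) / ln (real n)) \<longlonglongrightarrow> a ^ l / fact l"
proof -
  define r where "r n = n - spare_rows n" for n
  have "(\<lambda>n. real (r n choose l) / real (r n) ^ l) \<longlonglongrightarrow> 1 / fact l"
    using filterlim_compose[OF choose_div_power_tendsto rows_at_top] by (simp add: r_def)
  \<comment> \<open>There is one factor \<open>r n / n\<close> for each of the \<open>l\<close>
    chosen vertices and one for the number of lines; these and \<open>(1 - p n) ^ n\<close> tend to
    1.\<close>
  then have "(\<lambda>n. (real (r n choose l) / real (r n) ^ l) * (real (r n) / real n) ^ (l + 1) * (1 - p n) ^ n *
       (real n * (real n * p n) ^ l / ln (real n))) \<longlonglongrightarrow> 1 / fact l * 1 ^ (l + 1) * 1 * a ^ l"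
    using ratio_rows_tendsto vacant_line_tendsto np_power_tendsto
    by (intro tendsto_mult tendsto_power) (simp_all add: r_def)
  moreover have "\<forall>\<^sub>F n in sequentially. (real (r n choose l) / real (r n) ^ l) * (real (r n) / real n) ^ (l + 1) *
      (1 - p n) ^ n * (real n * (real n * p n) ^ l / ln (real n)) =
      crowded_bound n * real (n - spare_rows n) / ln (real n)"
    using eventually_ge_at_top[of 1] eventually_compose_filterlim[OF eventually_ge_at_top[of 1] rows_at_top]
  proof eventually_elim
    case (elim n)
    have "real (r n) \<noteq> 0" using elim(2) by (simp add: r_def)
    moreover have "crowded_bound n * real (n - spare_rows n) = real (r n choose l) * p n ^ l * (1 - p n) ^ n * real (r n)"
      by (simp add: crowded_bound_def r_def)
    ultimately show ?case using elim(1) by (simp add: power_mult_distrib power_divide)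
  qed
  ultimately have "(\<lambda>n. crowded_bound n * real (n - spare_rows n) / ln (real n)) \<longlonglongrightarrow> 1 / fact l * 1 ^ (l + 1) * 1 * a ^ l"
    by (rule Lim_transform_eventually)
  then show ?thesis by simp
qed

text \<open>The first summand, for bad layers, is at most a constant times
  \<open>n powr (h - b)\<close>. In the second, the exponent is driven by the expected number of
  seeds, which diverges as \<open>h > 1 / l\<close>.\<close>

lemma abundant_error_tendsto_0:
  assumes "1 / real l < h" "h < b" "b < (1 - t) * (a ^ l / fact l)" "0 < t" "t < 1"
  defines "N \<equiv> \<lambda>n. nat \<lfloor>real n powr h\<rfloor>"
  shows "(\<lambda>n. N n * (2 * (exp (- (1 - t) * (crowded_bound n * real (n - spare_rows n))) / t ^ (2 * l + 1))) +
    2 * exp (- ((n choose (l + 1)) * p n ^ (l + 1) * (1 - p n) ^ n * (N n * spare_rows n)) / 2)) \<longlonglongrightarrow> 0"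
proof -
  have h: "0 < h" "h < b" using assms l by (auto intro: less_trans[of 0 "1 / real l"])
  have N: "\<forall>\<^sub>F n in sequentially. 1 \<le> real (N n) \<and> real (N n) \<le> real n powr h \<and> real n powr h / 2 \<le> real (N n)"
    unfolding N_def by (rule floor_powr_bounds[OF h(1)])
  have "(\<lambda>n. N n * (2 * (exp (- (1 - t) * (crowded_bound n * real (n - spare_rows n))) / t ^ (2 * l + 1)))) \<longlonglongrightarrow> 0"
  proof (rule tendsto_sandwich[OF _ _ tendsto_const])
    have "(\<lambda>n. real n powr h * real n powr (- b)) \<longlonglongrightarrow> 0" using h by real_asymp
    from tendsto_mult[OF this tendsto_const, of "2 / t ^ (2 * l + 1)"]
    show "(\<lambda>n. real n powr h * real n powr (- b) * (2 / t ^ (2 * l + 1))) \<longlonglongrightarrow> 0" by simp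
    have "(\<lambda>n. (1 - t) * (crowded_bound n * real (n - spare_rows n) / ln (real n))) \<longlonglongrightarrow> (1 - t) * (a ^ l / fact l)"
      by (intro tendsto_mult tendsto_const crowded_bound_tendsto)
    then have "\<forall>\<^sub>F n in sequentially. b < (1 - t) * (crowded_bound n * real (n - spare_rows n) / ln (real n))"
      by (rule order_tendstoD) (rule assms)
    then show "\<forall>\<^sub>F n in sequentially.
        N n * (2 * (exp (- (1 - t) * (crowded_bound n * real (n - spare_rows n))) / t ^ (2 * l + 1))) \<le>
        real n powr h * real n powr (- b) * (2 / t ^ (2 * l + 1))"
      using N eventually_ge_at_top[of 2]
    proof eventually_elim
      case (elim n)
      have "b * ln (real n) \<le> (1 - t) * (crowded_bound n * real (n - spare_rows n))"
        using elim(1,3) by (simp add: pos_less_divide_eq)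
      then have "exp (- (1 - t) * (crowded_bound n * real (n - spare_rows n))) \<le> real n powr (- b)"
        using elim(3) by (simp add: powr_def algebra_simps)
      then have "real (N n) * exp (- (1 - t) * (crowded_bound n * real (n - spare_rows n))) \<le> real n powr h * real n powr (- b)"
        using elim(2) by (intro mult_mono) auto
      then have "real (N n) * exp (- (1 - t) * (crowded_bound n * real (n - spare_rows n))) * (2 / t ^ (2 * l + 1)) \<le>
         real n powr h * real n powr (- b) * (2 / t ^ (2 * l + 1))"
        using assms(4) by (intro mult_right_mono) auto
      then show ?case by (simp add: mult_ac)
    qed
    show "\<forall>\<^sub>F n in sequentially.
        0 \<le> N n * (2 * (exp (- (1 - t) * (crowded_bound n * real (n - spare_rows n))) / t ^ (2 * l + 1)))"
      using assms(4) by simp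
  qed
  moreover have "(\<lambda>n. exp (- ((n choose (l + 1)) * p n ^ (l + 1) * (1 - p n) ^ n * (N n * spare_rows n)) / 2)) \<longlonglongrightarrow> 0"
  proof -
    \<comment> \<open>Collects the factors with a positive limit; what remains of the seed count is
      the quantity of \<open>np_power_Suc_at_top\<close>.\<close>
    have "(\<lambda>n. real (n choose (l + 1)) / real n ^ (l + 1) * (1 - p n) ^ n *
        (real (spare_rows n) / (real n / ln (real n)))) \<longlonglongrightarrow> 1 / fact (l + 1) * 1 * 1"
      by (intro tendsto_mult choose_div_power_tendsto vacant_line_tendsto spare_rows_tendsto)
    then have "filterlim (\<lambda>n. real (n choose (l + 1)) / real n ^ (l + 1) * (1 - p n) ^ n *
        (real (spare_rows n) / (real n / ln (real n))) *
        (real n powr h * (real n / ln (real n)) * (real n * p n) ^ (l + 1))) at_top sequentially"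
      by (rule filterlim_tendsto_pos_mult_at_top) (use np_power_Suc_at_top[OF assms(1)] in simp_all)
    \<comment> \<open>The factor \<open>1 / 2\<close> pays for rounding \<open>n powr h\<close> down
      to \<open>N n\<close>.\<close>
    then have "filterlim (\<lambda>n. 1 / 2 * (real (n choose (l + 1)) / real n ^ (l + 1) * (1 - p n) ^ n *
        (real (spare_rows n) / (real n / ln (real n))) *
        (real n powr h * (real n / ln (real n)) * (real n * p n) ^ (l + 1)))) at_top sequentially"
      by (intro filterlim_tendsto_pos_mult_at_top[OF tendsto_const]) auto
    then have "filterlim (\<lambda>n. (n choose (l + 1)) * p n ^ (l + 1) * (1 - p n) ^ n * (N n * spare_rows n)) at_top sequentially"
    proof (rule filterlim_at_top_mono)
      show "\<forall>\<^sub>F n in sequentially. 1 / 2 * (real (n choose (l + 1)) / real n ^ (l + 1) * (1 - p n) ^ n *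
        (real (spare_rows n) / (real n / ln (real n))) *
        (real n powr h * (real n / ln (real n)) * (real n * p n) ^ (l + 1))) \<le>
        (n choose (l + 1)) * p n ^ (l + 1) * (1 - p n) ^ n * (N n * spare_rows n)"
        using N eventually_ge_at_top[of 2]
      proof eventually_elim
        case (elim n)
        let ?A = "real (n choose (l + 1)) * p n ^ (l + 1) * (1 - p n) ^ n"
        have "1 / 2 * (real (n choose (l + 1)) / real n ^ (l + 1) * (1 - p n) ^ n *
          (real (spare_rows n) / (real n / ln (real n))) *
          (real n powr h * (real n / ln (real n)) * (real n * p n) ^ (l + 1))) =
          ?A * (real n powr h / 2 * real (spare_rows n))"
          using elim(2) by (simp add: power_mult_distrib del: binomial_Suc_Suc)
        also have "\<dots> \<le> ?A * (real (N n) * real (spare_rows n))"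
          using elim(1) p01[of n] by (intro mult_left_mono mult_right_mono) auto
        finally show ?case by simp
      qed
    qed
    then show ?thesis by (rule exp_minus_half_tendsto_0)
  qed
  ultimately show ?thesis
    by (rule tendsto_add_zero[OF _ tendsto_mult_right_zero])
qed

end

text \<open>The ratio of logarithms eventually exceeds \<open>h / \<gamma> < 1\<close>, so
  \<open>m n\<close> exceeds \<open>n powr h\<close> and the window fits into the cycle.\<close>

lemma eventually_many_layers:
  fixes m :: "nat \<Rightarrow> nat"
  assumes m: "(\<lambda>n. ln (real (m n))) \<sim>[sequentially] (\<lambda>n. \<gamma> * ln (real n))" and h: "0 < h" "h < \<gamma>"
  shows "\<forall>\<^sub>F n in sequentially. 2 \<le> m n \<and> nat \<lfloor>real n powr h\<rfloor> \<le> m n"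
proof -
  have "\<forall>\<^sub>F n in sequentially. ln (real (m n)) \<noteq> 0 \<or> \<gamma> * ln (real n) \<noteq> 0"
    using eventually_ge_at_top[of 2] by eventually_elim (use h in auto)
  then have "(\<lambda>n. ln (real (m n)) / (\<gamma> * ln (real n))) \<longlonglongrightarrow> 1"
    by (rule asymp_equivD_strong[OF m])
  then have "\<forall>\<^sub>F n in sequentially. h / \<gamma> < ln (real (m n)) / (\<gamma> * ln (real n))"
    by (rule order_tendstoD) (use h in simp)
  then show ?thesis using eventually_ge_at_top[of 2]
  proof eventually_elim
    case (elim n)
    have L: "0 < ln (real n)" using elim(2) by simp
    have lt: "h * ln (real n) < ln (real (m n))"
      using elim(1) L h by (simp add: field_simps)
    with L h have "0 < ln (real (m n))" by (meson less_trans mult_pos_pos)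
    then have m1: "1 < m n" by (cases "m n = 0") auto
    have "real n powr h = exp (h * ln (real n))" using elim(2) by (simp add: powr_def)
    also have "\<dots> \<le> exp (ln (real (m n)))" using lt by simp
    also have "\<dots> = real (m n)" using m1 by simp
    finally have "real n powr h \<le> real (m n)" .
    then show ?case using m1 by (simp add: floor_le_iff nat_le_iff)
  qed
qed

section \<open>The two regimes\<close>

context critical_density
begin

lemma scarce_final_occupied:
  assumes small: "a ^ l / fact l < 1 / real l" and \<gamma>: "1 / real l < \<gamma>"
    and m: "(\<lambda>n. ln (real (m n))) \<sim>[sequentially] (\<lambda>n. \<gamma> * ln (real n))"
  shows "scarce (\<lambda>n. bernoulli_field (vertex_box (m n) n) (p n)) (\<lambda>n. vertex_box (m n) n)
    (\<lambda>n. final_occupied (layered_graph (m n) n) (2 * l + 1))"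
proof -
  \<comment> \<open>\<open>b\<close> is the exponent bounding the blocker probability,
    \<open>h\<close> that of the window; \<open>h < 1 / l < \<gamma>\<close> also lets the window
    fit into the cycle.\<close>
  obtain b where b: "a ^ l / fact l < b" "b < 1 / real l" using dense[OF small] by auto
  obtain h where h: "b < h" "h < 1 / real l" using dense[OF b(2)] by auto
  have "0 < a ^ l / fact l" using a by simp
  then have h0: "0 < h" using b h by linarith
  show ?thesis
  proof (rule scarceI[OF _ _ scarce_error_tendsto_0[OF b(1) h]])
    show "final_occupied (layered_graph (m n) n) (2 * l + 1) \<omega> \<subseteq> vertex_box (m n) n" for n \<omega>
      by (auto simp: final_occupied_def pverts_layered_graph)
    have "\<forall>\<^sub>F n in sequentially. (real n * p n) ^ l / fact l < 1"
      by (rule order_tendstoD[OF row_prob_tendsto_0]) simp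
    moreover have "\<forall>\<^sub>F n in sequentially. 2 \<le> m n \<and> nat \<lfloor>real n powr h\<rfloor> \<le> m n"
      using h h0 \<gamma> by (intro eventually_many_layers[OF m]) auto
    ultimately show "\<forall>\<^sub>F n in sequentially. finite (vertex_box (m n) n) \<and> vertex_box (m n) n \<noteq> {} \<and>
      (\<forall>v\<in>vertex_box (m n) n. field_prob (vertex_box (m n) n) (p n)
        {\<omega>. v \<in> final_occupied (layered_graph (m n) n) (2 * l + 1) \<omega>} \<le>
      p n + 4 * exp (- (no_row_bound n * real (nat \<lfloor>real n powr h\<rfloor>)) / 2) +
      (2 * real (nat \<lfloor>real n powr h\<rfloor>) + 1) * (2 * (real n * (real n * p n) ^ (l + 1))) +
      4 * real (nat \<lfloor>real n powr h\<rfloor>) * (4 ^ l * real n * (real n * p n) ^ (2 * l)))"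
      using eventually_ge_at_top[of 1]
    proof eventually_elim
      case (elim n)
      show ?case
      proof (intro conjI ballI)
        have "(0, 0, 0) \<in> vertex_box (m n) n" using elim by auto
        then show "vertex_box (m n) n \<noteq> {}" by blast
        fix v assume "v \<in> vertex_box (m n) n"
        then obtain k x y where v: "v = (k, x, y)" "k < m n" "x < n" "y < n" by auto
        from prob_final_occupied_le[OF v(2-4) conjunct2[OF elim(2)] conjunct1[OF elim(2)] p01 l less_imp_le[OF elim(1)]]
        show "field_prob (vertex_box (m n) n) (p n)
            {\<omega>. v \<in> final_occupied (layered_graph (m n) n) (2 * l + 1) \<omega>} \<le>
          p n + 4 * exp (- (no_row_bound n * real (nat \<lfloor>real n powr h\<rfloor>)) / 2) +
          (2 * real (nat \<lfloor>real n powr h\<rfloor>) + 1) * (2 * (real n * (real n * p n) ^ (l + 1))) +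
          4 * real (nat \<lfloor>real n powr h\<rfloor>) * (4 ^ l * real n * (real n * p n) ^ (2 * l))"
          unfolding v(1) no_row_bound_def .
      qed simp
    qed
  qed
qed

lemma abundant_final_occupied:
  assumes large: "a ^ l / fact l > 1 / real l" and \<gamma>: "1 / real l < \<gamma>"
    and m: "(\<lambda>n. ln (real (m n))) \<sim>[sequentially] (\<lambda>n. \<gamma> * ln (real n))"
  shows "abundant (\<lambda>n. bernoulli_field (vertex_box (m n) n) (p n)) (\<lambda>n. vertex_box (m n) n)
    (\<lambda>n. final_occupied (layered_graph (m n) n) (2 * l + 1))"
proof -
  define c where "c = a ^ l / fact l"
  \<comment> \<open>Below \<open>c\<close> the whole window consists of good layers with high
    probability; below \<open>\<gamma>\<close> it fits into the cycle.\<close>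
  obtain h where h: "1 / real l < h" "h < min c \<gamma>" using dense[of "1 / real l" "min c \<gamma>"] large \<gamma> by (auto simp: c_def)
  have "0 < 1 / real l" using l by simp
  then have h0: "0 < h" using h by linarith
  \<comment> \<open>Makes \<open>(1 - t) * c\<close> the midpoint of \<open>h\<close> and
    \<open>c\<close>.\<close>
  define t where "t = (c - h) / (2 * c)"
  have c0: "0 < c" using h h0 by simp
  then have t: "0 < t" "t < 1" "h < (1 - t) * c" using h h0 by (auto simp: t_def field_simps)
  obtain b where b: "h < b" "b < (1 - t) * (a ^ l / fact l)" using dense[OF t(3)] by (auto simp: c_def)
  show ?thesis
  proof (rule abundantI[OF _ _ abundant_error_tendsto_0[OF h(1) b t(1,2)]])
    show "final_occupied (layered_graph (m n) n) (2 * l + 1) \<omega> \<subseteq> vertex_box (m n) n" for n \<omega>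
      by (auto simp: final_occupied_def pverts_layered_graph)
    have "\<forall>\<^sub>F n in sequentially. 2 \<le> m n \<and> nat \<lfloor>real n powr h\<rfloor> \<le> m n"
      using h h0 by (intro eventually_many_layers[OF m]) auto
    moreover have "\<forall>\<^sub>F n in sequentially. l + 1 \<le> n - spare_rows n"
      using rows_at_top by (simp only: filterlim_at_top)
    ultimately show "\<forall>\<^sub>F n in sequentially. finite (vertex_box (m n) n) \<and> vertex_box (m n) n \<noteq> {} \<and>
      (\<forall>v\<in>vertex_box (m n) n. field_prob (vertex_box (m n) n) (p n)
        {\<omega>. v \<notin> final_occupied (layered_graph (m n) n) (2 * l + 1) \<omega>} \<le>
      real (nat \<lfloor>real n powr h\<rfloor>) *
      (2 * (exp (- (1 - t) * (crowded_bound n * real (n - spare_rows n))) / t ^ (2 * l + 1))) +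
      2 * exp (- ((n choose (l + 1)) * p n ^ (l + 1) * (1 - p n) ^ n * (nat \<lfloor>real n powr h\<rfloor> * spare_rows n)) / 2))"
      using eventually_ge_at_top[of 1]
    proof eventually_elim
      case (elim n)
      show ?case
      proof (intro conjI ballI)
        have "(0, 0, 0) \<in> vertex_box (m n) n" using elim by auto
        then show "vertex_box (m n) n \<noteq> {}" by blast
        fix v assume "v \<in> vertex_box (m n) n"
        then obtain k x y where v: "v = (k, x, y)" "k < m n" "x < n" "y < n" by auto
        from prob_not_full[OF v(2-4) conjunct2[OF elim(1)] conjunct1[OF elim(1)] p01 elim(2) t(1,2)]
        show "field_prob (vertex_box (m n) n) (p n)
            {\<omega>. v \<notin> final_occupied (layered_graph (m n) n) (2 * l + 1) \<omega>} \<le>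
          real (nat \<lfloor>real n powr h\<rfloor>) *
          (2 * (exp (- (1 - t) * (crowded_bound n * real (n - spare_rows n))) / t ^ (2 * l + 1))) +
          2 * exp (- ((n choose (l + 1)) * p n ^ (l + 1) * (1 - p n) ^ n * (nat \<lfloor>real n powr h\<rfloor> * spare_rows n)) / 2)"
          unfolding v(1) crowded_bound_def .
      qed simp
    qed
  qed
qed

end

theorem theorem1p3:
  fixes l \<theta> :: nat and \<gamma> a :: real
    and m :: "nat \<Rightarrow> nat" and p :: "nat \<Rightarrow> real"
    and G :: "nat \<Rightarrow> (nat \<times> nat \<times> nat) pair_pre_digraph"
  assumes "l \<ge> 1"
    and "\<theta> = 2 * l + 1"
    and "\<gamma> > 1 / real l"
    and "(\<lambda>n. ln (real (m n))) \<sim>[sequentially] (\<lambda>n. \<gamma> * ln (real n))"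
    and "\<And>n. p n \<in> {0..1}"
    and "a > 0"
    and "p \<sim>[sequentially]
           (\<lambda>n. a * (ln (real n) powr (1 / real l) / real n powr (1 + 1 / real l)))"
    and "\<And>n. G n = cycle_graph (m n) \<box> full_graph n \<box> full_graph n"
  shows "(a ^ l / fact l < 1 / real l \<longrightarrow>
           scarce (\<lambda>n. initial_law (G n) (p n)) (\<lambda>n. pverts (G n))
             (\<lambda>n. final_occupied (G n) \<theta>)) \<and>
         (a ^ l / fact l > 1 / real l \<longrightarrow>
           abundant (\<lambda>n. initial_law (G n) (p n)) (\<lambda>n. pverts (G n))
             (\<lambda>n. final_occupied (G n) \<theta>))"
proof -
  interpret critical_density l a p
    using assms(1,5,6,7) by unfold_locales auto
  have G: "G = (\<lambda>n. layered_graph (m n) n)" using assms(8) by (simp add: fun_eq_iff)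
  show ?thesis
    unfolding G initial_law_def pverts_layered_graph assms(2)
    using scarce_final_occupied[OF _ assms(3,4)] abundant_final_occupied[OF _ assms(3,4)] by blast
qed

end
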